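(* Let $n\ge2$, let $\Sigma$ be a surface diffeomorphic to a compact torus, let $\ell:\Sigma\to\mathbb{R}^{2n}$ be a smooth isotropic immersion, and let $p:\mathbb{R}^2\to\Sigma$ be a given conformal covering map, from which the quadrangulations $\mathcal{Q}_N(\Sigma)$ are constructed. Then there exists a family of isotropic quadrangular meshes $\rho_N\in\mathscr{M}_N$, defined for every $N$ sufficiently large, with the following property: for every $\epsilon>0$ there exists $N_0>0$ such that for every $N\ge N_0$ and every vertex $v$ of $\mathcal{Q}_N(\Sigma)$, $$\|\rho_N(v)-\ell(v)\|\le\epsilon.$$
   Context: $\mathbb{R}^{2n}\cong\mathbb{C}^n$ carries its Euclidean metric $g$ and standard symplectic form $\omega=d\lambda$, with $\lambda$ the Liouville form; $\ell$ isotropic means $\ell^*\omega=0$. A conformal covering map $p:\mathbb{R}^2\to\Sigma$ is a covering map which is conformal from the Euclidean metric to $\ell^*g$, with group of deck transformations a lattice $\Gamma$ of translations of $\mathbb{R}^2$; such a map exists by the uniformization theorem. Quadrangulations. Let $(e_1,e_2)$ be the canonical basis of $\mathbb{R}^2$. For an integer $N\ge1$ let $\Lambda_N=\frac1N\mathbb{Z}^2$ and let $\Lambda_N^{ch}\subset\Lambda_N$ be the sublattice spanned by $\frac{e_1+e_2}{N}$ and $\frac{e_2-e_1}{N}$. Fix an oriented basis $(\gamma_1,\gamma_2)$ of $\Gamma$ and for $i=1,2$ let $\gamma_i^N\in\Lambda_N^{ch}$ be a point of $\Lambda_N^{ch}$ closest to $\gamma_i$. For $N$ large $\gamma_1^N,\gamma_2^N$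 are linearly independent; let $\Gamma_N$ be the lattice they span, $U_N$ the linear automorphism of $\mathbb{R}^2$ with $U_N\gamma_i^N=\gamma_i$, and $p_N=p\circ U_N:\mathbb{R}^2\to\Sigma$, a covering map with deck group $\Gamma_N$. $\mathcal{Q}_N(\mathbb{R}^2)$ is the square grid with vertex set $\Lambda_N$ and faces the squares of side $1/N$; it is $\Gamma_N$-invariant and descends via $p_N$ to a quadrangulation $\mathcal{Q}_N(\Sigma)$ of $\Sigma$. Meshes. $\mathscr{M}_N=C^0(\mathcal{Q}_N(\Sigma))\otimes\mathbb{R}^{2n}$ is the space of maps $\tau$ from the set of vertices of $\mathcal{Q}_N(\Sigma)$ to $\mathbb{R}^{2n}$; its elements are called quadrangular meshes. The mesh $\tau$ is isotropic if, for each face of $\mathcal{Q}_N(\Sigma)$ with cyclically ordered vertices $v_0,v_1,v_2,v_3$, the integral of $\lambda$ along the closed polygon $\tau(v_0)\tau(v_1)\tau(v_2)\tau(v_3)$ vanishes; equivalently $\omega(\tau(v_2)-\tau(v_0),\tau(v_3)-\tau(v_1))=0$. *)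

theory Defs
  imports "HOL-Analysis.Analysis"
begin

section \<open>Smooth maps between open subsets of normed spaces\<close>

text \<open>Only meant for open \<open>S\<close>, on which \<open>Ck_on k\<close> is the usual class \<open>C\<^sup>k\<close>
  when the domain is finite-dimensional.\<close>

primrec Ck_on ::
  "nat \<Rightarrow> 'a::real_normed_vector set \<Rightarrow> ('a \<Rightarrow> 'b::real_normed_vector) \<Rightarrow> bool" where
  "Ck_on 0 S f \<longleftrightarrow> continuous_on S f"
| "Ck_on (Suc k) S f \<longleftrightarrow>
     (\<forall>x\<in>S. f differentiable (at x)) \<and> (\<forall>v. Ck_on k S (\<lambda>x. frechet_derivative f (at x) v))"

definition smooth_on ::
  "'a::real_normed_vector set \<Rightarrow> ('a \<Rightarrow> 'b::real_normed_vector) \<Rightarrow> bool" where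
  "smooth_on S f \<longleftrightarrow> (\<forall>k. Ck_on k S f)"


section \<open>Smooth manifolds\<close>

text \<open>A manifold is a set \<open>M\<close> with its subspace topology, together with an atlas. A chart is a pair
  \<open>(U, \<phi>)\<close> of an open subset of \<open>M\<close> and a coordinate map on it; the values of \<open>\<phi>\<close> outside \<open>U\<close> are
  irrelevant. Atlases need not be maximal. Surfaces are modelled on \<open>real ^ 2\<close>.\<close>

type_synonym ('a, 'b) chart = "'a set \<times> ('a \<Rightarrow> 'b)"

definition chart_inv :: "('a, 'b) chart \<Rightarrow> 'b \<Rightarrow> 'a" where
  "chart_inv c = inv_into (fst c) (snd c)"

definition is_chart ::
  "'a::topological_space set \<Rightarrow> ('a, 'b::euclidean_space) chart \<Rightarrow> bool" where
  "is_chart M c \<longleftrightarrow> openin (top_of_set M) (fst c) \<and> open (snd c ` fst c) \<and>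
     (\<exists>\<psi>. homeomorphism (fst c) (snd c ` fst c) (snd c) \<psi>)"

definition smooth_manifold ::
  "'a::topological_space set \<Rightarrow> ('a, 'b::euclidean_space) chart set \<Rightarrow> bool" where
  "smooth_manifold M A \<longleftrightarrow>
     Hausdorff_space (top_of_set M) \<and> second_countable (top_of_set M) \<and>
     (\<forall>c\<in>A. is_chart M c) \<and> \<Union>(fst ` A) = M \<and>
     (\<forall>c\<in>A. \<forall>d\<in>A. smooth_on (snd c ` (fst c \<inter> fst d)) (snd d \<circ> chart_inv c))"

definition id_chart :: "('b, 'b) chart" where
  "id_chart = (UNIV, id)"

definition smooth_map ::
  "'a::topological_space set \<Rightarrow> ('a, 'b::euclidean_space) chart set \<Rightarrow>
   'c::topological_space set \<Rightarrow> ('c, 'd::euclidean_space) chart set \<Rightarrow> ('a \<Rightarrow> 'c) \<Rightarrow> bool" where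
  "smooth_map M A M' B f \<longleftrightarrow>
     continuous_on M f \<and> f ` M \<subseteq> M' \<and>
     (\<forall>c\<in>A. \<forall>d\<in>B. smooth_on (snd c ` (fst c \<inter> f -` fst d)) (snd d \<circ> f \<circ> chart_inv c))"

definition diffeomorphic ::
  "'a::topological_space set \<Rightarrow> ('a, 'b::euclidean_space) chart set \<Rightarrow>
   'c::topological_space set \<Rightarrow> ('c, 'd::euclidean_space) chart set \<Rightarrow> bool" where
  "diffeomorphic M A M' B \<longleftrightarrow>
     (\<exists>f g. smooth_map M A M' B f \<and> smooth_map M' B M A g \<and>
            (\<forall>x\<in>M. g (f x) = x) \<and> (\<forall>y\<in>M'. f (g y) = y))"

text \<open>The differential of \<open>f\<close> at the point \<open>x\<close> read in a chart \<open>c\<close> at \<open>x\<close> and a chart \<open>d\<close> at \<open>f x\<close>.\<close>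

definition chart_deriv ::
  "('a, 'b::euclidean_space) chart \<Rightarrow> ('c, 'd::euclidean_space) chart \<Rightarrow> ('a \<Rightarrow> 'c) \<Rightarrow> 'a \<Rightarrow> 'b \<Rightarrow> 'd"
where
  "chart_deriv c d f x = frechet_derivative (snd d \<circ> f \<circ> chart_inv c) (at (snd c x))"


section \<open>The standard torus\<close>

definition torus_cover :: "real ^ 2 \<Rightarrow> complex \<times> complex" where
  "torus_cover x = (cis (2 * pi * x $ 1), cis (2 * pi * x $ 2))"

definition torus :: "(complex \<times> complex) set" where
  "torus = sphere 0 1 \<times> sphere 0 1"

text \<open>The charts are all the local inverses of the covering map.\<close>

definition torus_atlas :: "(complex \<times> complex, real ^ 2) chart set" where
  "torus_atlas = {(torus_cover ` W, inv_into W torus_cover) | W. open W \<and> inj_on torus_cover W}"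


section \<open>Symplectic geometry of \<open>\<complex>\<^sup>n\<close>\<close>

text \<open>With \<open>z\<^sub>i = x\<^sub>i + \<i> y\<^sub>i\<close> this is \<open>\<omega> = \<Sum>\<^sub>i dx\<^sub>i \<and> dy\<^sub>i\<close>, and
  \<open>\<lambda> = 1/2 \<Sum>\<^sub>i (x\<^sub>i dy\<^sub>i - y\<^sub>i dx\<^sub>i)\<close>, so that \<open>d\<lambda> = \<omega>\<close>; since only integrals of \<open>\<lambda>\<close> along closed
  curves occur, any other primitive of \<open>\<omega>\<close> would do as well. The Euclidean metric is the
  inner product of \<open>complex ^ 'n\<close>.\<close>

definition symp :: "complex ^ 'n \<Rightarrow> complex ^ 'n \<Rightarrow> real" where
  "symp u v = (\<Sum>i\<in>UNIV. Re (u $ i) * Im (v $ i) - Im (u $ i) * Re (v $ i))"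

definition liouville :: "complex ^ 'n \<Rightarrow> complex ^ 'n \<Rightarrow> real" where
  "liouville z v = (1 / 2) * (\<Sum>i\<in>UNIV. Re (z $ i) * Im (v $ i) - Im (z $ i) * Re (v $ i))"

definition liouville_integral :: "(real \<Rightarrow> complex ^ 'n) \<Rightarrow> real" where
  "liouville_integral \<gamma> =
     integral {0..1} (\<lambda>t. liouville (\<gamma> t) (vector_derivative \<gamma> (at t within {0..1})))"

definition smooth_immersion ::
  "'a::topological_space set \<Rightarrow> ('a, 'b::euclidean_space) chart set \<Rightarrow>
   ('a \<Rightarrow> 'd::euclidean_space) \<Rightarrow> bool" where
  "smooth_immersion M A f \<longleftrightarrow> smooth_map M A UNIV {id_chart} f \<and>
     (\<forall>c\<in>A. \<forall>x\<in>fst c. inj (chart_deriv c id_chart f x))"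

definition isotropic_map ::
  "('a, 'b::euclidean_space) chart set \<Rightarrow> ('a \<Rightarrow> complex ^ 'n) \<Rightarrow> bool" where
  "isotropic_map A f \<longleftrightarrow>
     (\<forall>c\<in>A. \<forall>x\<in>fst c. \<forall>u v.
        symp (chart_deriv c id_chart f x u) (chart_deriv c id_chart f x v) = 0)"


section \<open>Conformal coverings\<close>

definition lattice_span :: "'b::real_vector \<Rightarrow> 'b \<Rightarrow> 'b set" where
  "lattice_span a b = {of_int i *\<^sub>R a + of_int j *\<^sub>R b | i j :: int. True}"

definition oriented_basis_of :: "(real ^ 2) set \<Rightarrow> real ^ 2 \<Rightarrow> real ^ 2 \<Rightarrow> bool" where
  "oriented_basis_of \<Gamma> a b \<longleftrightarrow> \<Gamma> = lattice_span a b \<and> 0 < det (vector [a, b] :: real ^ 2 ^ 2)"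

definition deck_transformations :: "('b::topological_space \<Rightarrow> 'a) \<Rightarrow> ('b \<Rightarrow> 'b) set" where
  "deck_transformations p = {T. (\<exists>T'. homeomorphism UNIV UNIV T T') \<and> p \<circ> T = p}"

text \<open>The metric induced by \<open>f\<close> from the Euclidean one, at \<open>x\<close>, read in the chart \<open>c\<close>.\<close>

definition induced_metric ::
  "('a, 'b::euclidean_space) chart \<Rightarrow> ('a \<Rightarrow> 'd::euclidean_space) \<Rightarrow> 'a \<Rightarrow> 'b \<Rightarrow> 'b \<Rightarrow> real" where
  "induced_metric c f x u v = chart_deriv c id_chart f x u \<bullet> chart_deriv c id_chart f x v"

definition conformal_map ::
  "('a::topological_space) set \<Rightarrow> ('a, real ^ 2) chart set \<Rightarrow> ('a \<Rightarrow> 'd::euclidean_space) \<Rightarrow>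
   (real ^ 2 \<Rightarrow> 'a) \<Rightarrow> bool" where
  "conformal_map M A f p \<longleftrightarrow> smooth_map UNIV {id_chart} M A p \<and>
     (\<forall>x. \<exists>r>0. \<forall>c\<in>A. p x \<in> fst c \<longrightarrow>
        (\<forall>u v. induced_metric c f (p x) (chart_deriv id_chart c p x u) (chart_deriv id_chart c p x v)
               = r * (u \<bullet> v)))"

definition conformal_covering ::
  "('a::topological_space) set \<Rightarrow> ('a, real ^ 2) chart set \<Rightarrow> ('a \<Rightarrow> 'd::euclidean_space) \<Rightarrow>
   (real ^ 2 \<Rightarrow> 'a) \<Rightarrow> (real ^ 2) set \<Rightarrow> bool" where
  "conformal_covering M A f p \<Gamma> \<longleftrightarrow>
     covering_space UNIV p M \<and> conformal_map M A f p \<and>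
     (\<exists>a b. oriented_basis_of \<Gamma> a b) \<and>
     deck_transformations p = {(\<lambda>x. x + \<gamma>) | \<gamma>. \<gamma> \<in> \<Gamma>}"


section \<open>Quadrangulations and meshes\<close>

abbreviation e1 :: "real ^ 2" where "e1 \<equiv> axis 1 1"
abbreviation e2 :: "real ^ 2" where "e2 \<equiv> axis 2 1"

definition grid :: "nat \<Rightarrow> (real ^ 2) set" where
  "grid N = lattice_span (e1 /\<^sub>R real N) (e2 /\<^sub>R real N)"

definition grid_ch :: "nat \<Rightarrow> (real ^ 2) set" where
  "grid_ch N = lattice_span ((e1 + e2) /\<^sub>R real N) ((e2 - e1) /\<^sub>R real N)"

text \<open>The linear automorphism sending \<open>a'\<close> to \<open>a\<close> and \<open>b'\<close> to \<open>b\<close>; it is well defined once \<open>a', b'\<close>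
  are linearly independent (and an arbitrary map otherwise).\<close>

definition basis_change ::
  "real ^ 2 \<Rightarrow> real ^ 2 \<Rightarrow> real ^ 2 \<Rightarrow> real ^ 2 \<Rightarrow> real ^ 2 \<Rightarrow> real ^ 2" where
  "basis_change a b a' b' = (THE U. linear U \<and> U a' = a \<and> U b' = b)"

text \<open>The following two are applied to \<open>q = p\<^sub>N\<close>. A face is represented by its cyclically
  ordered vertices.\<close>

definition quad_vertices :: "nat \<Rightarrow> (real ^ 2 \<Rightarrow> 'a) \<Rightarrow> 'a set" where
  "quad_vertices N q = q ` grid N"

definition quad_faces :: "nat \<Rightarrow> (real ^ 2 \<Rightarrow> 'a) \<Rightarrow> ('a \<times> 'a \<times> 'a \<times> 'a) set" where
  "quad_faces N q =
     {(q v, q (v + e1 /\<^sub>R real N), q (v + (e1 + e2) /\<^sub>R real N), q (v + e2 /\<^sub>R real N)) | v. v \<in> grid N}"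

definition quad_meshes :: "nat \<Rightarrow> (real ^ 2 \<Rightarrow> 'a) \<Rightarrow> ('a \<Rightarrow> complex ^ 'n) set" where
  "quad_meshes N q = quad_vertices N q \<rightarrow>\<^sub>E UNIV"

definition isotropic_mesh :: "nat \<Rightarrow> (real ^ 2 \<Rightarrow> 'a) \<Rightarrow> ('a \<Rightarrow> complex ^ 'n) \<Rightarrow> bool" where
  "isotropic_mesh N q \<tau> \<longleftrightarrow>
     (\<forall>(v0, v1, v2, v3) \<in> quad_faces N q.
        liouville_integral (linepath (\<tau> v0) (\<tau> v1)) + liouville_integral (linepath (\<tau> v1) (\<tau> v2)) +
        liouville_integral (linepath (\<tau> v2) (\<tau> v3)) + liouville_integral (linepath (\<tau> v3) (\<tau> v0)) = 0)"


section \<open>Consistency of the definitions\<close>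

lemma liouville_integral_linepath:
  "liouville_integral (linepath a b) = (1 / 2) * symp a b"
proof -
  have "liouville_integral (linepath a b) = integral {0..1} (\<lambda>t::real. (1/2) * symp a b)"
    unfolding liouville_integral_def
  proof (rule integral_cong)
    fix t :: real assume t: "t \<in> {0..1}"
    have vd: "vector_derivative (linepath a b) (at t within {0..1}) = b - a"
      by (rule vector_derivative_linepath_within) (use t in auto)
    show "liouville (linepath a b t) (vector_derivative (linepath a b) (at t within {0..1}))
           = (1/2) * symp a b"
      unfolding vd unfolding liouville_def symp_def linepath_def
      by (rule arg_cong[where f="\<lambda>x. (1/2) * x"], rule sum.cong) (auto simp: algebra_simps)
  qed
  then show ?thesis by simp
qed

lemma isotropic_mesh_iff:
  "isotropic_mesh N q \<tau> \<longleftrightarrow>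
     (\<forall>(v0, v1, v2, v3) \<in> quad_faces N q. symp (\<tau> v2 - \<tau> v0) (\<tau> v3 - \<tau> v1) = 0)"
proof -
  have "symp a b + symp b c + symp c d + symp d a = symp (c - a) (d - b)" for a b c d :: "complex ^ 'n"
    unfolding symp_def by (simp add: sum.distrib[symmetric] algebra_simps)
  then have "(1/2) * symp a b + (1/2) * symp b c + (1/2) * symp c d + (1/2) * symp d a = 0 \<longleftrightarrow>
      symp (c - a) (d - b) = 0" for a b c d :: "complex ^ 'n"
    by (metis (no_types) distrib_left mult_eq_0_iff zero_neq_numeral divide_eq_0_iff zero_neq_one)
  then show ?thesis
    unfolding isotropic_mesh_def liouville_integral_linepath
    by (intro ball_cong refl) (simp add: case_prod_beta)
qed

lemma Ck_on_cong:
  assumes "open S" "\<And>x. x \<in> S \<Longrightarrow> f x = g x" "Ck_on k S g"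
  shows "Ck_on k S f"
  using assms(2,3)
proof (induction k arbitrary: f g)
  case 0
  then show ?case by (simp cong: continuous_on_cong)
next
  case (Suc k)
  have d: "(f has_derivative D) (at x) \<longleftrightarrow> (g has_derivative D) (at x)" if "x \<in> S" for x D
    using has_derivative_transform_within_open[of f D x UNIV S g]
      has_derivative_transform_within_open[of g D x UNIV S f] assms(1) Suc.prems(1) that by metis
  then have "frechet_derivative f (at x) = frechet_derivative g (at x)" if "x \<in> S" for x
    using that by (simp add: frechet_derivative_def)
  moreover have "f differentiable (at x) \<longleftrightarrow> g differentiable (at x)" if "x \<in> S" for x
    using d that by (simp add: differentiable_def)
  ultimately show ?case using Suc.prems(2) Suc.IH by auto
qed

lemma Ck_on_const: "Ck_on k S (\<lambda>_. c)"
  by (induction k arbitrary: c) (auto simp: frechet_derivative_const)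

lemma smooth_on_locally_translation:
  fixes f :: "'a::real_normed_vector \<Rightarrow> 'a"
  assumes S: "open S"
    and loc: "\<And>x. x \<in> S \<Longrightarrow> \<exists>T c. open T \<and> x \<in> T \<and> (\<forall>y\<in>T. f y = y + c)"
  shows "smooth_on S f"
proof -
  have d: "(f has_derivative (\<lambda>v. v)) (at x)" if x: "x \<in> S" for x
  proof -
    obtain T c where T: "open T" "x \<in> T" "\<forall>y\<in>T. f y = y + c" using loc x by blast
    have "((\<lambda>y. y + c) has_derivative (\<lambda>v. v)) (at x)" by (auto intro!: derivative_eq_intros)
    then show ?thesis
      using has_derivative_transform_within_open[of "\<lambda>y. y + c" "\<lambda>v. v" x UNIV T f] T by auto
  qed
  have fd: "frechet_derivative f (at x) v = v" if "x \<in> S" for x v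
    using frechet_derivative_at[OF d[OF that]] by metis
  have "Ck_on k S f" for k
  proof (cases k)
    case 0
    then show ?thesis using d by (auto intro!: continuous_at_imp_continuous_on dest: has_derivative_continuous)
  next
    case (Suc j)
    have "Ck_on j S (\<lambda>x. frechet_derivative f (at x) v)" for v
      by (rule Ck_on_cong[OF S fd Ck_on_const])
    then show ?thesis using Suc d by (auto simp: differentiable_def)
  qed
  then show ?thesis by (simp add: smooth_on_def)
qed

lemma cis_eq_iff: "cis a = cis b \<longleftrightarrow> (\<exists>k::int. a = b + 2 * pi * of_int k)"
proof -
  have "cis a = cis b \<longleftrightarrow> exp (\<i> * of_real a) = exp (\<i> * of_real b)" by (simp add: cis_conv_exp)
  also have "\<dots> \<longleftrightarrow> (\<exists>n::int. \<i> * of_real a = \<i> * of_real b + (of_int (2 * n) * pi) * \<i>)"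
    by (rule exp_eq)
  also have "\<dots> \<longleftrightarrow> (\<exists>k::int. a = b + 2 * pi * of_int k)"
    by (auto simp: complex_eq_iff algebra_simps)
  finally show ?thesis .
qed

lemma torus_cover_eq_iff:
  "torus_cover x = torus_cover y \<longleftrightarrow> (\<exists>i j::int. x = y + vector [of_int i, of_int j])"
proof -
  have *: "cis (2*pi*a) = cis (2*pi*b) \<longleftrightarrow> (\<exists>k::int. a = b + of_int k)" for a b
  proof -
    have "2*pi*a = 2*pi*b + 2*pi * of_int k \<longleftrightarrow> a = b + of_int k" for k
    proof -
      have "2*pi*b + 2*pi * of_int k = 2*pi*(b + of_int k)" by (simp add: algebra_simps)
      then show ?thesis by simp
    qed
    then show ?thesis unfolding cis_eq_iff by simp
  qed
  show ?thesis
    unfolding torus_cover_def prod.inject * by (simp add: vec_eq_iff forall_2)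
qed

lemma continuous_torus_cover: "continuous_on S torus_cover"
  unfolding torus_cover_def by (intro continuous_intros)

lemma torus_cover_range: "torus_cover ` UNIV = torus"
proof
  show "torus_cover ` UNIV \<subseteq> torus" by (auto simp: torus_cover_def torus_def)
  show "torus \<subseteq> torus_cover ` UNIV"
  proof
    fix z assume "z \<in> torus"
    then have n: "norm (fst z) = 1" "norm (snd z) = 1" by (auto simp: torus_def)
    have "z = torus_cover (vector [Arg (fst z) / (2*pi), Arg (snd z) / (2*pi)])"
      using n by (simp add: torus_cover_def prod_eq_iff) (metis cis_Arg norm_zero sgn_eq zero_neq_one div_by_1 of_real_1)
    then show "z \<in> torus_cover ` UNIV" by blast
  qed
qed

lemma torus_cover_open_map:
  assumes W: "open W"
  shows "openin (top_of_set torus) (torus_cover ` W)"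
  unfolding openin_contains_ball
proof (intro conjI ballI)
  show "torus_cover ` W \<subseteq> torus" using torus_cover_range by blast
  fix z assume "z \<in> torus_cover ` W"
  then obtain x0 where x0: "x0 \<in> W" "z = torus_cover x0" by blast
  define g where "g y = x0 + (\<chi> i. if i = 1 then Arg (fst y / fst z) / (2*pi) else Arg (snd y / snd z) / (2*pi))" for y
  have nz: "fst z \<noteq> 0" "snd z \<noteq> 0" "norm (fst z) = 1" "norm (snd z) = 1"
    by (auto simp: x0 torus_cover_def)
  have "isCont (\<lambda>y. Arg (fst y / fst z) / (2*pi)) z"
    by (intro continuous_intros continuous_at_compose[of z _ Arg, unfolded o_def] continuous_at_Arg)
       (use nz in \<open>auto\<close>)
  moreover have "isCont (\<lambda>y. Arg (snd y / snd z) / (2*pi)) z"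
    by (intro continuous_intros continuous_at_compose[of z _ Arg, unfolded o_def] continuous_at_Arg)
       (use nz in \<open>auto\<close>)
  ultimately have c: "isCont g z"
    unfolding g_def isCont_def by (intro tendsto_add tendsto_const tendsto_vec_lambda) (simp split: if_split)
  have gz: "g z = x0" using nz by (simp add: g_def vec_eq_iff forall_2)
  have cg: "torus_cover (g y) = y" if y: "y \<in> torus" for y
  proof -
    have 1: "cis (2*pi*(a + Arg w / (2*pi))) = cis (2*pi*a) * w" if "norm w = 1" for a w
    proof -
      have "w = cis (Arg w)" using that by (metis cis_Arg norm_zero sgn_eq zero_neq_one div_by_1 of_real_1)
      moreover have "2*pi*(a + Arg w / (2*pi)) = 2*pi*a + Arg w" by (simp add: field_simps)
      ultimately show ?thesis by (metis cis_mult)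
    qed
    have "norm (fst y / fst z) = 1" "norm (snd y / snd z) = 1"
      using y nz by (auto simp: torus_def norm_divide)
    then have "torus_cover (g y) = (cis (2*pi*x0$1) * (fst y / fst z), cis (2*pi*x0$2) * (snd y / snd z))"
      unfolding torus_cover_def g_def by (simp add: 1)
    also have "\<dots> = y" using nz x0(2) by (simp add: torus_cover_def)
    finally show ?thesis .
  qed
  obtain e where e: "e > 0" "ball x0 e \<subseteq> W" using W x0(1) openE by blast
  then obtain d where d: "d > 0" "\<forall>y. dist y z < d \<longrightarrow> dist (g y) x0 < e"
    using c[unfolded continuous_at_eps_delta] gz by metis
  have "ball z d \<inter> torus \<subseteq> torus_cover ` W"
  proof
    fix y assume y: "y \<in> ball z d \<inter> torus"
    then have "dist y z < d" by (simp add: dist_commute)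
    then have "dist (g y) x0 < e" using d(2) by blast
    then have "g y \<in> W" using e(2) by (auto simp: dist_commute subset_iff)
    then show "y \<in> torus_cover ` W" using cg y by (metis IntD2 imageI)
  qed
  then show "\<exists>e>0. ball z e \<inter> torus \<subseteq> torus_cover ` W" using d by blast
qed

lemma smooth_manifold_torus: "smooth_manifold torus torus_atlas"
proof -
  have H: "Hausdorff_space (top_of_set torus)"
    by (simp add: Hausdorff_space_subtopology)
  have SC: "second_countable (top_of_set torus)"
    by (intro second_countable_subtopology)
       (metis second_countable_def ex_countable_basis topological_basis_open open_openin topological_basisE)
  have ch: "is_chart torus (torus_cover ` W, inv_into W torus_cover)"
    if W: "open W" "inj_on torus_cover W" for W
  proof -
    have im: "inv_into W torus_cover ` torus_cover ` W = W" using W by (simp add: inv_into_image_cancel)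
    have "openin (top_of_set (torus_cover ` W)) (torus_cover ` V)"
      if "openin (top_of_set W) V" for V
    proof -
      have "open V" "V \<subseteq> W" using that W by (auto simp: openin_open_eq)
      moreover have "torus_cover ` W \<subseteq> torus" using torus_cover_range by blast
      ultimately show ?thesis
        using openin_subset_trans[OF torus_cover_open_map[of V], of "torus_cover ` W"] by blast
    qed
    then obtain g where g: "homeomorphism W (torus_cover ` W) torus_cover g"
      using homeomorphism_injective_open_map[OF continuous_torus_cover refl W(2)] by blast
    have g': "homeomorphism (torus_cover ` W) W g torus_cover" using g homeomorphism_symD by blast
    have ginv: "g y = inv_into W torus_cover y" if y: "y \<in> torus_cover ` W" for y
    proof -
      obtain x where x: "x \<in> W" "y = torus_cover x" using y by blast
      then show ?thesis using homeomorphism_apply1[OF g x(1)] inv_into_f_f[OF W(2) x(1)] by simp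
    qed
    have "homeomorphism (torus_cover ` W) W (inv_into W torus_cover) torus_cover"
      by (rule homeomorphism_cong[OF g']) (simp_all add: ginv)
    then have "homeomorphism W (torus_cover ` W) torus_cover (inv_into W torus_cover)"
        "homeomorphism (torus_cover ` W) W (inv_into W torus_cover) torus_cover"
      using homeomorphism_symD by blast+
    then show ?thesis
      unfolding is_chart_def fst_conv snd_conv im using W(1) torus_cover_open_map[OF W(1)] by blast
  qed
  have cov: "\<Union> (fst ` torus_atlas) = torus"
  proof
    show "\<Union> (fst ` torus_atlas) \<subseteq> torus"
    proof -
      have "torus_cover ` W \<subseteq> torus" for W using torus_cover_range by blast
      then show ?thesis unfolding torus_atlas_def by fastforce
    qed
    show "torus \<subseteq> \<Union> (fst ` torus_atlas)"
    proof
      fix z assume "z \<in> torus"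
      then obtain x where x: "z = torus_cover x" using torus_cover_range by blast
      have inj: "inj_on torus_cover (ball x (1/2))"
      proof (rule inj_onI)
        fix u v assume uv: "u \<in> ball x (1/2)" "v \<in> ball x (1/2)" "torus_cover u = torus_cover v"
        then obtain i j :: int where ij: "u = v + vector [of_int i, of_int j]"
          using torus_cover_eq_iff by blast
        have "dist u v < 1" using uv(1,2) dist_triangle_half_r[of x u 1 v] by (auto simp: dist_commute)
        then have nn: "norm (u - v) < 1" by (simp add: dist_norm)
        have "\<bar>(u - v) $ 1\<bar> < 1" "\<bar>(u - v) $ 2\<bar> < 1"
          using component_le_norm_cart[of "u - v" 1] component_le_norm_cart[of "u - v" 2] nn by linarith+
        then have "i = 0" "j = 0" using ij by auto
        then show "u = v" using ij by (simp add: vec_eq_iff forall_2)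
      qed
      have "(torus_cover ` ball x (1/2), inv_into (ball x (1/2)) torus_cover) \<in> torus_atlas"
        unfolding torus_atlas_def using inj by blast
      moreover have "z \<in> torus_cover ` ball x (1/2)" using x by auto
      ultimately show "z \<in> \<Union> (fst ` torus_atlas)" by force
    qed
  qed
  have tr: "smooth_on (inv_into W torus_cover ` (torus_cover ` W \<inter> torus_cover ` V))
      (inv_into V torus_cover \<circ> chart_inv (torus_cover ` W, inv_into W torus_cover))"
    if W: "open W" "inj_on torus_cover W" and V: "open V" "inj_on torus_cover V" for W V
  proof -
    have ci: "chart_inv (torus_cover ` W, inv_into W torus_cover) y = torus_cover y" if "y \<in> W" for y
    proof -
      have "inv_into W torus_cover (torus_cover y) = y" using W that by simp
      moreover have "inj_on (inv_into W torus_cover) (torus_cover ` W)" by (simp add: inj_on_inv_into)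
      ultimately show ?thesis unfolding chart_inv_def using that
        by (metis fst_conv snd_conv image_eqI inv_into_f_f)
    qed
    have S: "inv_into W torus_cover ` (torus_cover ` W \<inter> torus_cover ` V) = W \<inter> torus_cover -` (torus_cover ` V)"
    proof -
      have "torus_cover ` W \<inter> torus_cover ` V = torus_cover ` (W \<inter> torus_cover -` (torus_cover ` V))"
        by blast
      then show ?thesis using inv_into_image_cancel[OF W(2)] by simp
    qed
    have oS: "open (W \<inter> torus_cover -` (torus_cover ` V))"
    proof -
      obtain Q where "open Q" "torus_cover ` V = torus \<inter> Q"
        using torus_cover_open_map[OF V(1)] by (auto simp: openin_open)
      moreover from this have "torus_cover -` (torus_cover ` V) = torus_cover -` Q"
        using torus_cover_range by blast
      moreover have "open (torus_cover -` Q)"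
        using \<open>open Q\<close> continuous_torus_cover[of UNIV] by (simp add: open_vimage)
      ultimately show ?thesis using W by auto
    qed
    show ?thesis unfolding S
    proof (rule smooth_on_locally_translation[OF oS])
      fix y assume y: "y \<in> W \<inter> torus_cover -` (torus_cover ` V)"
      then obtain v where v: "v \<in> V" "torus_cover v = torus_cover y" by auto
      then obtain i j :: int where ij: "v = y + vector [of_int i, of_int j]"
        using torus_cover_eq_iff by blast
      define c :: "real ^ 2" where "c = vector [of_int i, of_int j]"
      define T where "T = W \<inter> (\<lambda>u. u + c) -` V"
      have "open T" unfolding T_def using W V by (intro open_Int open_vimage) (auto intro!: continuous_intros)
      moreover have "y \<in> T" using y v ij by (auto simp: T_def c_def)
      moreover have "(inv_into V torus_cover \<circ> chart_inv (torus_cover ` W, inv_into W torus_cover)) u = u + c"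
        if "u \<in> T" for u
      proof -
        have "torus_cover (u + c) = torus_cover u" unfolding torus_cover_eq_iff c_def by blast
        then have "inv_into V torus_cover (torus_cover u) = u + c"
          using that V(2) unfolding T_def by (metis IntD2 inv_into_f_f vimageD)
        then show ?thesis using that ci by (simp add: T_def)
      qed
      ultimately show "\<exists>T c. open T \<and> y \<in> T \<and> (\<forall>u\<in>T.
        (inv_into V torus_cover \<circ> chart_inv (torus_cover ` W, inv_into W torus_cover)) u = u + c)" by blast
    qed
  qed
  have "is_chart torus c" if "c \<in> torus_atlas" for c
    using that ch unfolding torus_atlas_def by blast
  moreover have "smooth_on (snd c ` (fst c \<inter> fst d)) (snd d \<circ> chart_inv c)"
    if cd: "c \<in> torus_atlas" "d \<in> torus_atlas" for c d
  proof -
    obtain W V where W: "open W" "inj_on torus_cover W" "c = (torus_cover ` W, inv_into W torus_cover)"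
      and V: "open V" "inj_on torus_cover V" "d = (torus_cover ` V, inv_into V torus_cover)"
      using cd unfolding torus_atlas_def by blast
    show ?thesis unfolding W(3) V(3) fst_conv snd_conv by (rule tr[OF W(1,2) V(1,2)])
  qed
  ultimately show ?thesis unfolding smooth_manifold_def using H SC cov by blast
qed

end

theory Submission
  imports Defs
begin

text \<open>Since \<open>\<Gamma>\<^sub>N\<close> lies in the checkerboard
  sublattice, the vertices of the quadrangulation are either even or odd, and every face has an even
  and an odd diagonal. Displace the even vertices \<open>u\<close> to \<open>g u = l u + d P (c u)\<close>, where \<open>P\<close> runs
  through finitely many points of a moment curve in \<open>\<complex>\<^sup>2\<close>, any four of which are linearly independent,
  and the colouring \<open>c\<close> separates the four neighbours of each odd vertex. With
  \<open>\<phi> u = d \<omega>(P (c u), l u)\<close>, move each odd vertex \<open>x\<close> to a point \<open>T\<close> such that \<open>\<omega>(g u, T) - \<phi> u\<close> does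
  not depend on the neighbour \<open>u\<close> of \<open>x\<close>; all faces are then isotropic. If \<open>\<eta>\<close> bounds the variation
  of \<open>l\<close> along an edge, this is a \<open>4 \<times> 4\<close> linear system for \<open>T - l x\<close>, uniformly invertible after
  division by \<open>d\<close>, with right-hand side of size \<open>O(\<eta> + \<eta>/d)\<close>; so first \<open>d\<close> and then \<open>\<eta>\<close>
  are chosen small.\<close>

section \<open>Linear symplectic algebra\<close>

lemma symp_simps:
  "symp (a + b) v = symp a v + symp b v"
  "symp (a - b) v = symp a v - symp b v"
  "symp u (c + d) = symp u c + symp u d"
  "symp u (c - d) = symp u c - symp u d"
  "symp (t *\<^sub>R u) v = t * symp u v"
  "symp u (t *\<^sub>R v) = t * symp u v"
  "symp u 0 = 0"
  by (simp_all add: symp_def sum.distrib sum_subtractf sum_distrib_left algebra_simps)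

lemma symp_self [simp]: "symp u u = 0"
  by (simp add: symp_def)

lemma symp_commute: "symp u v = - symp v u"
  by (simp add: symp_def sum_negf [symmetric] algebra_simps)

lemma symp_sum_right: "symp u (sum g S) = (\<Sum>x\<in>S. symp u (g x))"
  by (induction S rule: infinite_finite_induct) (simp_all add: symp_simps)

text \<open>Each summand is the imaginary part of \<open>cnj (u $ i) * v $ i\<close>, hence at most
  \<open>norm u * norm v\<close> in absolute value; the factor \<open>CARD('n)\<close> counts the
  summands.\<close>

lemma abs_symp_le:
  fixes u v :: "complex ^ 'n"
  shows "\<bar>symp u v\<bar> \<le> real CARD('n) * (norm u * norm v)"
proof -
  have "\<bar>Re (u $ i) * Im (v $ i) - Im (u $ i) * Re (v $ i)\<bar> \<le> norm u * norm v" for i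
  proof -
    have "\<bar>Re (u $ i) * Im (v $ i) - Im (u $ i) * Re (v $ i)\<bar> = \<bar>Im (cnj (u $ i) * v $ i)\<bar>"
      by simp
    also have "\<dots> \<le> norm (u $ i) * norm (v $ i)"
      by (metis abs_Im_le_cmod complex_mod_cnj norm_mult)
    also have "\<dots> \<le> norm u * norm v"
      by (intro mult_mono) (auto intro: Finite_Cartesian_Product.norm_nth_le)
    finally show ?thesis .
  qed
  then have "\<bar>symp u v\<bar> \<le> (\<Sum>i\<in>(UNIV :: 'n set). norm u * norm v)"
    unfolding symp_def by (intro order_trans[OF sum_abs] sum_mono)
  then show ?thesis by simp
qed

text \<open>In the real coordinates of two complex axes, \<open>P t\<close> is the moment curve
  \<open>(1, t, t^2, t^3)\<close>. Since \<open>symp\<close> is nondegenerate on this 4-dimensional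
  space, pairing with a suitable \<open>Q\<close> produces any prescribed cubic polynomial in
  \<open>t\<close>.\<close>

lemma symplectic_moment_curve:
  assumes "CARD('n) \<ge> 2"
  shows "\<exists>P :: real \<Rightarrow> complex ^ 'n. \<forall>q0 q1 q2 q3. \<exists>Q. \<forall>t. symp (P t) Q = q0 + q1 * t + q2 * t^2 + q3 * t^3"
proof -
  obtain a b :: 'n where ab: "a \<noteq> b"
    using assms card_le_Suc0_iff_eq[of "UNIV :: 'n set"] by auto
  define w :: "complex \<Rightarrow> complex \<Rightarrow> complex ^ 'n" where
    "w y z = (\<chi> i. if i = a then y else if i = b then z else 0)" for y z
  have s: "symp (w y z) (w y' z') = Re y * Im y' - Im y * Re y' + (Re z * Im z' - Im z * Re z')" for y z y' z'
  proof -
    have "symp (w y z) (w y' z') = (\<Sum>i\<in>{a, b}. Re (w y z $ i) * Im (w y' z' $ i) - Im (w y z $ i) * Re (w y' z' $ i))"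
      unfolding symp_def by (rule sum.mono_neutral_right) (auto simp: w_def)
    then show ?thesis using ab by (simp add: w_def)
  qed
  have "\<forall>q0 q1 q2 q3. \<exists>Q. \<forall>t. symp (w (Complex 1 t) (Complex (t^2) (t^3))) Q = q0 + q1 * t + q2 * t^2 + q3 * t^3"
  proof (intro allI exI)
    show "symp (w (Complex 1 t) (Complex (t^2) (t^3))) (w (Complex (- q1) q0) (Complex (- q3) q2))
            = q0 + q1 * t + q2 * t^2 + q3 * t^3" for q0 q1 q2 q3 t
      by (simp add: s algebra_simps)
  qed
  then show ?thesis by (intro exI[of _ "\<lambda>t. w (Complex 1 t) (Complex (t^2) (t^3))"])
qed

text \<open>Lagrange interpolation: the dual vector \<open>Q j\<close> realises the cubic that is 1
  at the parameter \<open>k j\<close> and 0 at the other three.\<close>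

lemma symplectic_dual_frames:
  assumes "CARD('n) \<ge> 2"
  shows "\<exists>P :: nat \<Rightarrow> complex ^ 'n. \<forall>k :: 4 \<Rightarrow> nat. inj k \<longrightarrow>
           (\<exists>Q. \<forall>i j. symp (P (k i)) (Q j) = (if i = j then 1 else 0))"
proof -
  obtain P :: "real \<Rightarrow> complex ^ 'n"
    where P: "\<And>q0 q1 q2 q3. \<exists>Q. \<forall>t. symp (P t) Q = q0 + q1 * t + q2 * t^2 + q3 * t^3"
    using symplectic_moment_curve[OF assms] by metis
  have L: "\<exists>Q. \<forall>t. symp (P t) Q = e * ((t - a) * (t - b) * (t - c))" for a b c e
  proof -
    obtain Q where "\<forall>t. symp (P t) Q = - (e*a*b*c) + (e*(a*b + a*c + b*c)) * t + (- (e*(a+b+c))) * t^2 + e * t^3"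
      using P by metis
    then show ?thesis by (intro exI[of _ Q]) (simp add: algebra_simps power2_eq_square power3_eq_cube)
  qed
  have "\<exists>Q. \<forall>i j. symp (P (real (k i))) (Q j) = (if i = j then 1 else 0)" if k: "inj k" for k :: "4 \<Rightarrow> nat"
  proof -
    have ne: "real (k i) - real (k j) \<noteq> 0" if "i \<noteq> j" for i j using k that by (simp add: inj_eq)
    have "\<exists>q. \<forall>i. symp (P (real (k i))) q = (if i = j then 1 else 0)" for j
    proof -
      \<comment> \<open>The three remaining indices supply the roots of the Lagrange cubic belonging
        to \<open>j\<close>.\<close>
      obtain a b c where abc: "a \<noteq> j" "b \<noteq> j" "c \<noteq> j" "\<And>i. i \<noteq> j \<Longrightarrow> i = a \<or> i = b \<or> i = c"
      proof -
        consider "j = 1" | "j = 2" | "j = 3" | "j = 4" using exhaust_4[of j] by blast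
        then show ?thesis
          by cases (rule that[of 2 3 4] that[of 1 3 4] that[of 1 2 4] that[of 1 2 3]; use exhaust_4 in auto)+
      qed
      obtain q where q: "\<And>t. symp (P t) q = inverse ((real (k j) - k a) * (real (k j) - k b) * (real (k j) - k c)) * ((t - k a) * (t - k b) * (t - k c))"
        using L by metis
      have "symp (P (real (k i))) q = (if i = j then 1 else 0)" for i
        using abc(4)[of i] ne[OF abc(1)] ne[OF abc(2)] ne[OF abc(3)] abc(1-3) k
        by (auto simp: q inj_eq simp del: inverse_mult_distrib)
      then show ?thesis by blast
    qed
    then show ?thesis by metis
  qed
  then show ?thesis by (intro exI[of _ "\<lambda>m. P (real m)"]) auto
qed

text \<open>For \<open>w = P\<close> the dual vectors solve the system at once. For nearby
  \<open>w\<close>, and \<open>x\<close> restricted to the span of the \<open>Q j\<close>, the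
  matrix of the system is within distance 1/2 of the identity, so it stays invertible with an
  inverse of norm at most 2.\<close>

lemma symplectic_solve_near_frame:
  fixes P Q :: "4 \<Rightarrow> complex ^ 'n"
  assumes dual: "\<And>i j. symp (P i) (Q j) = (if i = j then 1 else 0)"
  shows "\<exists>e>0. \<exists>K\<ge>0. \<forall>w r. (\<forall>i. norm (w i - P i) \<le> e) \<longrightarrow>
           (\<exists>x. (\<forall>i. symp (w i) x = r $ i) \<and> norm x \<le> K * norm (r :: real ^ 4))"
proof -
  define n where "n = real CARD('n)"
  define S where "S = (\<Sum>j\<in>UNIV. norm (Q j))"
  have n: "n > 0" by (simp add: n_def)
  have S: "S \<ge> 0" by (simp add: S_def sum_nonneg)
  \<comment> \<open>The 8 makes each of the four components of \<open>f y - y\<close> at most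
    \<open>norm y / 8\<close>, so that their sum is at most \<open>norm y / 2\<close>;
    \<open>n\<close> is the factor from \<open>abs_symp_le\<close>, and \<open>S + 1\<close> is
    visibly positive.\<close>
  define e where "e = 1 / (8 * n * (S + 1))"
  have e: "e > 0" using n S by (simp add: e_def)
  define X where "X y = (\<Sum>j\<in>UNIV. (y $ j) *\<^sub>R Q j)" for y :: "real ^ 4"
  have X: "norm (X y) \<le> S * norm y" for y
  proof -
    have "norm (X y) \<le> (\<Sum>j\<in>UNIV. norm ((y $ j) *\<^sub>R Q j))" unfolding X_def by (rule norm_sum)
    also have "\<dots> \<le> (\<Sum>j\<in>UNIV. norm y * norm (Q j))"
      by (intro sum_mono) (auto intro: mult_right_mono component_le_norm_cart)
    finally show ?thesis by (simp add: S_def sum_distrib_left mult.commute)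
  qed
  have lX: "linear X"
    by (auto simp: X_def linear_iff scaleR_add_left sum.distrib scaleR_sum_right)
  have "\<exists>x. (\<forall>i. symp (w i) x = r $ i) \<and> norm x \<le> (2 * S) * norm r"
    if w: "\<forall>i. norm (w i - P i) \<le> e" for w and r :: "real ^ 4"
  proof -
    define f where "f y = (\<chi> i. symp (w i) (X y))" for y
    have lf: "linear f"
      by (auto simp: linear_iff f_def vec_eq_iff linear_add[OF lX] linear_cmul[OF lX] symp_simps)
    have PX: "symp (P i) (X y) = y $ i" for i y
      by (simp add: X_def symp_sum_right symp_simps dual if_distrib cong: if_cong)
    have "norm (f y - y) \<le> norm y / 2" for y
    proof -
      have "\<bar>(f y - y) $ i\<bar> \<le> norm y / 8" for i
      proof -
        have "(f y - y) $ i = symp (w i - P i) (X y)" by (simp add: f_def symp_simps PX)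
        then have "\<bar>(f y - y) $ i\<bar> \<le> n * (norm (w i - P i) * norm (X y))"
          using abs_symp_le unfolding n_def by metis
        also have "\<dots> \<le> n * (e * ((S + 1) * norm y))"
          using w X[of y] n e S by (intro mult_left_mono mult_mono) (auto simp: algebra_simps intro: order_trans)
        also have "\<dots> = (e * (8 * n * (S + 1))) * norm y / 8" by (simp add: algebra_simps)
        also have "\<dots> = norm y / 8" using n S by (simp add: e_def)
        finally show ?thesis .
      qed
      then have "(\<Sum>i\<in>UNIV. \<bar>(f y - y) $ i\<bar>) \<le> (\<Sum>i\<in>(UNIV :: 4 set). norm y / 8)"
        by (intro sum_mono)
      then show ?thesis using norm_le_l1_cart[of "f y - y"] by simp
    qed
    \<comment> \<open>This gives injectivity of \<open>f\<close> on \<open>real ^ 4\<close>, hence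
      surjectivity, and also the factor 2 in the constant \<open>2 * S\<close>.\<close>
    then have half: "norm y \<le> 2 * norm (f y)" for y
      using norm_triangle_sub[of y "f y"] by (smt (verit) field_sum_of_halves norm_minus_commute)
    have "inj f"
      using half lf by (simp add: linear_injective_0) (metis mult_zero_right norm_le_zero_iff norm_zero)
    then have "surj f" using linear_injective_imp_surjective[OF lf] by simp
    then obtain y where y: "r = f y" by (metis surjD)
    have "norm (X y) \<le> (2 * S) * norm r"
      using X[of y] mult_left_mono[OF half[of y] S] y by simp
    moreover have "symp (w i) (X y) = r $ i" for i by (simp add: y f_def)
    ultimately show ?thesis by blast
  qed
  then show ?thesis using e S by (intro exI[of _ e] conjI exI[of _ "2 * S"]) auto
qed

text \<open>Here \<open>d\<close> bounds the colours. Only finitely many injective \<open>k\<close>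
  take values up to \<open>d\<close>, so a minimum and a maximum over them turn the constants of the
  preceding lemma into constants valid for every vertex of every mesh.\<close>

lemma symplectic_solve_uniform:
  assumes "CARD('n) \<ge> 2"
  shows "\<exists>(P :: nat \<Rightarrow> complex ^ 'n) e K. e > 0 \<and> K \<ge> 0 \<and>
    (\<forall>(k :: 4 \<Rightarrow> nat) w r. inj k \<longrightarrow> (\<forall>i. k i \<le> d \<and> norm (w i - P (k i)) \<le> e) \<longrightarrow>
       (\<exists>x. (\<forall>i. symp (w i) x = r $ i) \<and> norm x \<le> K * norm r))"
proof -
  obtain P :: "nat \<Rightarrow> complex ^ 'n" where P: "\<And>k :: 4 \<Rightarrow> nat. inj k \<Longrightarrow>
           (\<exists>Q. \<forall>i j. symp (P (k i)) (Q j) = (if i = j then 1 else 0))"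
    using symplectic_dual_frames[OF assms] by metis
  define S where "S = {k :: 4 \<Rightarrow> nat. inj k \<and> (\<forall>i. k i \<le> d)}"
  have "finite {k :: 4 \<Rightarrow> nat. \<forall>i. (i \<in> UNIV \<longrightarrow> k i \<in> {..d}) \<and> (i \<notin> UNIV \<longrightarrow> k i = 0)}"
    by (rule finite_set_of_finite_funs) auto
  then have fS: "finite S" by (rule rev_finite_subset) (auto simp: S_def)
  have "\<exists>e K. e > 0 \<and> K \<ge> 0 \<and> (\<forall>w r. (\<forall>i. norm (w i - P (k i)) \<le> e) \<longrightarrow>
           (\<exists>x. (\<forall>i. symp (w i) x = r $ i) \<and> norm x \<le> K * norm (r :: real ^ 4)))" if "k \<in> S" for k
    using P[of k] that symplectic_solve_near_frame[of "\<lambda>i. P (k i)"] unfolding S_def by blast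
  then obtain e K where eK: "\<And>k. k \<in> S \<Longrightarrow> e k > 0 \<and> K k \<ge> 0 \<and> (\<forall>w r. (\<forall>i. norm (w i - P (k i)) \<le> e k) \<longrightarrow>
           (\<exists>x. (\<forall>i. symp (w i) x = r $ i) \<and> norm x \<le> K k * norm (r :: real ^ 4)))"
    by metis
  \<comment> \<open>The inserted 1 and 0 cover the case of empty \<open>S\<close>; the 0 also makes
    \<open>K'\<close> nonnegative.\<close>
  define e' where "e' = Min (insert 1 (e ` S))"
  define K' where "K' = Max (insert 0 (K ` S))"
  have "e' > 0" using fS eK by (auto simp: e'_def)
  moreover have "K' \<ge> 0" using fS by (simp add: K'_def)
  moreover have "\<exists>x. (\<forall>i. symp (w i) x = r $ i) \<and> norm x \<le> K' * norm r"
    if kw: "inj k" "\<forall>i. k i \<le> d \<and> norm (w i - P (k i)) \<le> e'" for k w and r :: "real ^ 4"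
  proof -
    have k: "k \<in> S" using kw by (simp add: S_def)
    then have le: "e' \<le> e k" "K k \<le> K'" using fS by (auto simp: e'_def K'_def)
    have "\<forall>i. norm (w i - P (k i)) \<le> e k" using kw(2) le(1) order_trans by blast
    then obtain x where x: "\<forall>i. symp (w i) x = r $ i" "norm x \<le> K k * norm r"
      using eK[OF k] by blast
    have "norm x \<le> K' * norm r"
      using x(2) mult_right_mono[OF le(2) norm_ge_zero] by (rule order_trans)
    then show ?thesis using x(1) by blast
  qed
  ultimately show ?thesis by blast
qed

section \<open>Meshes on a checkerboard\<close>

text \<open>Enumerate \<open>X\<close> and give each vertex the least colour not taken by its
  earlier neighbours: at most \<open>d\<close> colours are forbidden, so one of
  \<open>0, ..., d\<close> is free.\<close>

lemma greedy_colouring: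
  assumes "countable X" and sym: "\<And>x y. E x y \<Longrightarrow> E y x" and irr: "\<And>x. \<not> E x x"
    and deg: "\<And>x. x \<in> X \<Longrightarrow> finite {y. E x y} \<and> card {y. E x y} \<le> d"
  shows "\<exists>c :: 'a \<Rightarrow> nat. \<forall>x\<in>X. c x \<le> d \<and> (\<forall>y\<in>X. E x y \<longrightarrow> c x \<noteq> c y)"
proof -
  define num where "num = to_nat_on X"
  have inj: "inj_on num X" unfolding num_def using assms(1) by (rule inj_on_to_nat_on)
  define nb where "nb x = {y. E x y \<and> num y < num x}" for x
  \<comment> \<open>The recursion descends along the enumeration: the colour of \<open>x\<close>
    depends only on \<open>nb x\<close>, whose elements have smaller numbers.\<close>
  define c where "c = wfrec (inv_image less_than num) (\<lambda>c x. LEAST m :: nat. m \<notin> c ` nb x)"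
  have c: "c x = (LEAST m. m \<notin> c ` nb x)" for x
  proof -
    have "c x = (LEAST m. m \<notin> cut c (inv_image less_than num) x ` nb x)"
      unfolding c_def by (subst wfrec) auto
    moreover have "cut c (inv_image less_than num) x ` nb x = c ` nb x"
      by (intro image_cong) (auto simp: cut_def nb_def)
    ultimately show ?thesis by simp
  qed
  have fin: "finite (c ` nb x)" "card (c ` nb x) \<le> d" if "x \<in> X" for x
  proof -
    have s: "nb x \<subseteq> {y. E x y}" by (auto simp: nb_def)
    then show "finite (c ` nb x)" using deg[OF that] finite_subset by blast
    show "card (c ` nb x) \<le> d"
      using deg[OF that] s by (meson card_image_le card_mono finite_subset order_trans)
  qed
  have ex: "\<exists>m\<le>d. m \<notin> c ` nb x" if "x \<in> X" for x
  proof (rule ccontr)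
    assume "\<not> ?thesis"
    then have "{..d} \<subseteq> c ` nb x" by auto
    then have "card {..d} \<le> card (c ` nb x)" by (intro card_mono fin(1)[OF that])
    then show False using fin(2)[OF that] by simp
  qed
  have "c x \<le> d \<and> c x \<notin> c ` nb x" if x: "x \<in> X" for x
  proof -
    obtain m where m: "m \<le> d" "m \<notin> c ` nb x" using ex[OF x] by blast
    have "(LEAST m. m \<notin> c ` nb x) \<notin> c ` nb x" using m(2) by (rule LeastI)
    moreover have "(LEAST m. m \<notin> c ` nb x) \<le> m" using m(2) by (rule Least_le)
    ultimately show ?thesis using m(1) c[of x] by simp
  qed
  then have le: "c x \<le> d" and nin: "c x \<notin> c ` nb x" if "x \<in> X" for x
    using that by blast+
  have "c x \<noteq> c y" if xy: "x \<in> X" "y \<in> X" "E x y" for x y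
  proof -
    have "x \<noteq> y" using irr xy by auto
    then have "num x \<noteq> num y" using inj xy by (auto dest: inj_onD)
    \<comment> \<open>The later of two adjacent vertices has avoided the colour of the earlier
      one.\<close>
    then have "y \<in> nb x \<or> x \<in> nb y" using xy sym by (auto simp: nb_def)
    then show ?thesis using nin[OF xy(1)] nin[OF xy(2)] by (metis imageI)
  qed
  then show ?thesis using le by blast
qed

text \<open>The steps are indexed by the type \<open>4\<close> so that the conditions at the
  neighbours of a vertex form a system in \<open>real ^ 4\<close>.\<close>

definition shift :: "4 \<Rightarrow> int \<times> int" where
  "shift m = (if m = 1 then (1, 0) else if m = 2 then (0, 1) else if m = 3 then (- 1, 0) else (0, - 1))"

lemma shift_inj: "shift m = shift m' \<Longrightarrow> m = m'"
  using exhaust_4[of m] exhaust_4[of m'] by (auto simp: shift_def split: if_splits)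

text \<open>\<open>V i j\<close> stands for the image of a grid point in the torus. The assumptions
  keep what is needed of the lattice: identifications are translation invariant, preserve parity,
  and are trivial at short range. The range 2 is the largest coordinate difference between two
  neighbours of one point.\<close>

locale checkerboard =
  fixes V :: "int \<Rightarrow> int \<Rightarrow> 'a"
  assumes translate: "V i j = V i' j' \<Longrightarrow> V (i + a) (j + b) = V (i' + a) (j' + b)"
    and parity: "V i j = V i' j' \<Longrightarrow> even (i + j) \<longleftrightarrow> even (i' + j')"
    and separated: "V i j = V i' j' \<Longrightarrow> \<bar>i - i'\<bar> \<le> 2 \<Longrightarrow> \<bar>j - j'\<bar> \<le> 2 \<Longrightarrow> i = i' \<and> j = j'"
begin

definition nbr :: "int \<Rightarrow> int \<Rightarrow> 4 \<Rightarrow> 'a" where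
  "nbr i j m = V (i + fst (shift m)) (j + snd (shift m))"

text \<open>A greedy colouring of the graph that joins points at nonzero offsets in
  \<open>{-2..2} \<times> {-2..2}\<close>; any two distinct neighbours of a vertex are adjacent in
  it. The graph has no loops because of \<open>separated\<close>.\<close>

lemma colouring:
  "\<exists>c :: 'a \<Rightarrow> nat. (\<forall>i j. c (V i j) \<le> 25) \<and> (\<forall>i j. inj (\<lambda>m. c (nbr i j m)))"
proof -
  define E where "E x y \<longleftrightarrow> (\<exists>i j a b. x = V i j \<and> y = V (i + a) (j + b) \<and> \<bar>a\<bar> \<le> 2 \<and> \<bar>b\<bar> \<le> 2 \<and> (a, b) \<noteq> (0, 0))"
    for x y
  define X where "X = range (\<lambda>(i, j). V i j)"
  have "countable X" by (simp add: X_def)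
  moreover have "E y x" if xy: "E x y" for x y
  proof -
    obtain i j a b where "x = V i j" "y = V (i + a) (j + b)" "\<bar>a\<bar> \<le> 2" "\<bar>b\<bar> \<le> 2" "(a, b) \<noteq> (0, 0)"
      using xy unfolding E_def by blast
    then show ?thesis
      unfolding E_def by (intro exI[of _ "i + a"] exI[of _ "j + b"] exI[of _ "- a"] exI[of _ "- b"]) auto
  qed
  moreover have "\<not> E x x" for x
  proof
    assume "E x x"
    then obtain i j a b where ab: "V i j = V (i + a) (j + b)" "\<bar>a\<bar> \<le> 2" "\<bar>b\<bar> \<le> 2" "(a, b) \<noteq> (0, 0)"
      unfolding E_def using translate by metis
    then show False using separated[OF ab(1)] by simp
  qed
  moreover have "finite {y. E x y} \<and> card {y. E x y} \<le> 25" if xX: "x \<in> X" for x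
  proof -
    obtain i j where x: "x = V i j" using xX by (auto simp: X_def)
    \<comment> \<open>By \<open>translate\<close> all neighbours can be read off from the single
      representative \<open>(i, j)\<close>. The 25 counts all 5 by 5 offsets, the zero offset
      included.\<close>
    let ?S = "(\<lambda>(a, b). V (i + a) (j + b)) ` ({-2..2} \<times> {-2..2})"
    have "{y. E x y} \<subseteq> ?S"
    proof
      fix y assume "y \<in> {y. E x y}"
      then obtain i' j' a b where y: "x = V i' j'" "y = V (i' + a) (j' + b)" "\<bar>a\<bar> \<le> 2" "\<bar>b\<bar> \<le> 2"
        unfolding E_def by blast
      then have "y = V (i + a) (j + b)" using translate x by metis
      then show "y \<in> ?S" using y by (intro image_eqI[of _ _ "(a, b)"]) auto
    qed
    moreover have "card ?S \<le> 25" by (rule order_trans[OF card_image_le]) auto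
    ultimately show ?thesis by (meson card_mono finite_SigmaI finite_atLeastAtMost_int finite_imageI finite_subset order_trans)
  qed
  ultimately obtain c :: "'a \<Rightarrow> nat" where c: "\<And>x. x \<in> X \<Longrightarrow> c x \<le> 25 \<and> (\<forall>y\<in>X. E x y \<longrightarrow> c x \<noteq> c y)"
    using greedy_colouring[of X E 25] by metis
  have X: "V i j \<in> X" for i j by (auto simp: X_def)
  have "c (nbr i j m) \<noteq> c (nbr i j m')" if "m \<noteq> m'" for i j m m'
  proof -
    have "E (nbr i j m) (nbr i j m')"
      unfolding E_def nbr_def
    proof (intro exI conjI)
      show "V (i + fst (shift m')) (j + snd (shift m')) =
        V (i + fst (shift m) + (fst (shift m') - fst (shift m))) (j + snd (shift m) + (snd (shift m') - snd (shift m)))"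
        by simp
      show "(fst (shift m') - fst (shift m), snd (shift m') - snd (shift m)) \<noteq> (0, 0)"
        using that shift_inj[of m m'] by (auto simp: prod_eq_iff)
    qed (auto simp: shift_def)
    then show ?thesis using c X unfolding nbr_def by blast
  qed
  then have "inj (\<lambda>m. c (nbr i j m))" for i j by (metis injI)
  then show ?thesis using c X by blast
qed

text \<open>Let a face have even vertices \<open>u\<close>, \<open>u'\<close> and odd vertices
  \<open>x\<close>, \<open>x'\<close>. Subtracting the equations at \<open>u\<close> and
  \<open>u'\<close> removes \<open>k\<close>, so \<open>symp (g u - g u')\<close> takes the value
  \<open>\<phi> u - \<phi> u'\<close> at both \<open>T x\<close> and \<open>T x'\<close>. Hence it
  vanishes on their difference, which is isotropy of the face.\<close>

lemma isotropic_glue: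
  fixes g :: "'a \<Rightarrow> complex ^ 'n"
  assumes solve: "\<And>i j. odd (i + j) \<Longrightarrow> \<exists>T k. norm (T - f (V i j)) \<le> e \<and> (\<forall>m. symp (g (nbr i j m)) T = \<phi> (nbr i j m) + k)"
    and g: "\<And>i j. norm (g (V i j) - f (V i j)) \<le> e"
  shows "\<exists>\<tau>. (\<forall>i j. norm (\<tau> (V i j) - f (V i j)) \<le> e) \<and>
     (\<forall>i j. symp (\<tau> (V (i + 1) (j + 1)) - \<tau> (V i j)) (\<tau> (V i (j + 1)) - \<tau> (V (i + 1) j)) = 0)"
proof -
  \<comment> \<open>The condition is stated for the vertex \<open>x\<close> and all its coordinate
    representations at once, so that \<open>T\<close> and \<open>k\<close> can be chosen as
    functions on the torus; \<open>translate\<close> shows that the representations agree.\<close>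
  define N where "N x T k \<longleftrightarrow> norm (T - f x) \<le> e \<and> (\<forall>i j m. x = V i j \<longrightarrow> symp (g (nbr i j m)) T = \<phi> (nbr i j m) + k)" for x T k
  define Od where "Od = {V i j | i j. odd (i + j)}"
  have "\<exists>T k. N x T k" if xO: "x \<in> Od" for x
  proof -
    obtain i j where x: "x = V i j" "odd (i + j)" using xO unfolding Od_def by blast
    have "nbr i' j' m = nbr i j m" if "x = V i' j'" for i' j' m
      using that x translate unfolding nbr_def by metis
    then show ?thesis using solve[OF x(2)] unfolding N_def x(1) by metis
  qed
  then obtain T k where Tk: "\<And>x. x \<in> Od \<Longrightarrow> N x (T x) (k x)" by metis
  define \<tau> where "\<tau> x = (if x \<in> Od then T x else g x)" for x
  \<comment> \<open>By \<open>parity\<close>, oddness belongs to the vertex and not to its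
    coordinates.\<close>
  have od: "V i j \<in> Od \<longleftrightarrow> odd (i + j)" for i j
    using parity unfolding Od_def by blast
  have "norm (\<tau> (V i j) - f (V i j)) \<le> e" for i j
    using Tk[of "V i j"] g[of i j] by (auto simp: \<tau>_def N_def)
  moreover have "symp (\<tau> (V (i + 1) (j + 1)) - \<tau> (V i j)) (\<tau> (V i (j + 1)) - \<tau> (V (i + 1) j)) = 0" for i j
  proof -
    have s: "symp (g (nbr a b m)) (T (V a b)) = \<phi> (nbr a b m) + k (V a b)" if "odd (a + b)" for a b m
      using Tk[of "V a b"] that od[of a b] unfolding N_def by blast
    show ?thesis
    proof (cases "even (i + j)")
      case True
      \<comment> \<open>Here \<open>V (i + 1) j\<close> and \<open>V i (j + 1)\<close> are the odd
        vertices, and each has both even vertices of the face as neighbours.\<close>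
      have "nbr (i + 1) j 3 = V i j" "nbr (i + 1) j 2 = V (i + 1) (j + 1)"
        "nbr i (j + 1) 4 = V i j" "nbr i (j + 1) 1 = V (i + 1) (j + 1)"
        by (simp_all add: nbr_def shift_def)
      then show ?thesis
        using True s[of "i + 1" j 3] s[of "i + 1" j 2] s[of i "j + 1" 4] s[of i "j + 1" 1]
        by (simp add: \<tau>_def od symp_simps)
    next
      case False
      have n: "nbr i j 1 = V (i + 1) j" "nbr i j 2 = V i (j + 1)"
        "nbr (i + 1) (j + 1) 4 = V (i + 1) j" "nbr (i + 1) (j + 1) 3 = V i (j + 1)"
        by (simp_all add: nbr_def shift_def)
      have "symp (g (V i (j + 1)) - g (V (i + 1) j)) (T (V (i + 1) (j + 1)) - T (V i j)) = 0"
        using False n s[of i j 1] s[of i j 2] s[of "i + 1" "j + 1" 4] s[of "i + 1" "j + 1" 3]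
        by (simp add: symp_simps)
      then show ?thesis
        using False symp_commute[of "T (V (i + 1) (j + 1)) - T (V i j)"] by (simp add: \<tau>_def od)
    qed
  qed
  ultimately show ?thesis by blast
qed

text \<open>The assumptions on sizes have separate tasks: \<open>dM\<close> bounds the displacement
  of even vertices, \<open>\<eta>e\<close> keeps the vectors \<open>w\<close> within
  \<open>e\<close> of the frame, and \<open>\<eta>K\<close> bounds the displacement \<open>Q\<close>
  of odd vertices.\<close>

lemma isotropic_approximation_step:
  fixes f :: "'a \<Rightarrow> complex ^ 'n" and P :: "nat \<Rightarrow> complex ^ 'n"
  assumes solve: "\<And>(k :: 4 \<Rightarrow> nat) w r. inj k \<Longrightarrow> (\<And>i. k i \<le> 25 \<and> norm (w i - P (k i)) \<le> e) \<Longrightarrow>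
       (\<exists>x. (\<forall>i. symp (w i) x = r $ i) \<and> norm x \<le> K * norm r)"
    and K: "K \<ge> 0" and d: "d > 0"
    and P: "\<And>k. k \<le> 25 \<Longrightarrow> norm (P k) \<le> M"
    and B: "\<And>i j. norm (f (V i j)) \<le> B"
    and cont: "\<And>i j m. norm (f (nbr i j m) - f (V i j)) \<le> \<eta>"
    and dM: "d * M \<le> \<epsilon>" and \<eta>e: "\<eta> \<le> e * d"
    and \<eta>K: "K * (4 * (real CARD('n) * ((M + B / d) * \<eta>))) \<le> \<epsilon>"
  shows "\<exists>\<tau>. (\<forall>i j. norm (\<tau> (V i j) - f (V i j)) \<le> \<epsilon>) \<and>
     (\<forall>i j. symp (\<tau> (V (i + 1) (j + 1)) - \<tau> (V i j)) (\<tau> (V i (j + 1)) - \<tau> (V (i + 1) j)) = 0)"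
proof -
  define n where "n = real CARD('n)"
  obtain c :: "'a \<Rightarrow> nat" where c: "\<And>i j. c (V i j) \<le> 25" "\<And>i j. inj (\<lambda>m. c (nbr i j m))"
    using colouring by metis
  define g where "g x = f x + d *\<^sub>R P (c x)" for x
  define \<phi> where "\<phi> x = d * symp (P (c x)) (f x)" for x
  show ?thesis
  proof (rule isotropic_glue[where g = g and \<phi> = \<phi>])
    show "norm (g (V i j) - f (V i j)) \<le> \<epsilon>" for i j
      using d order_trans[OF mult_left_mono[OF P[OF c(1)]] dM, of i j] by (simp add: g_def)
  next
    fix i j :: int
    define x where "x = V i j"
    define u where "u m = nbr i j m" for m
    have cu: "c (u m) \<le> 25" for m using c(1) by (simp add: u_def nbr_def)
    have \<eta>: "norm (f (u m) - f x) \<le> \<eta>" for m using cont by (simp add: u_def x_def)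
    have \<eta>0: "\<eta> \<ge> 0" using \<eta>[of 1] norm_ge_zero order_trans by blast
    have M0: "M \<ge> 0" using P[of 0] norm_ge_zero order_trans by blast
    \<comment> \<open>With \<open>T = f x + Q\<close> and
      \<open>g (u m) = f x + d *\<^sub>R w m\<close>, the condition at \<open>u m\<close> becomes
      \<open>symp (w m) Q = r $ m\<close>, once the constant is taken to be
      \<open>symp (f x) Q\<close>.\<close>
    define r :: "real ^ 4" where "r = (\<chi> m. (\<phi> (u m) - symp (g (u m)) (f x)) / d)"
    define w where "w m = P (c (u m)) + (f (u m) - f x) /\<^sub>R d" for m
    have "norm (w m - P (c (u m))) \<le> e" for m
    proof -
      have "norm (w m - P (c (u m))) \<le> \<eta> / d"
        using divide_right_mono[OF \<eta>[of m], of d] d by (simp add: w_def divide_inverse mult.commute)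
      also have "\<dots> \<le> e" using \<eta>e d by (simp add: field_simps)
      finally show ?thesis .
    qed
    then obtain Q where Q: "\<And>m. symp (w m) Q = r $ m" "norm Q \<le> K * norm r"
      using solve[of "\<lambda>m. c (u m)" w r] c(2)[of i j] cu unfolding u_def by blast
    have "\<bar>r $ m\<bar> \<le> n * ((M + B / d) * \<eta>)" for m
    proof -
      \<comment> \<open>Since \<open>symp (f x) (f x) = 0\<close>, and \<open>\<phi>\<close> was
        chosen to match the displacement \<open>d *\<^sub>R P\<close>, only terms containing the
        small difference \<open>f (u m) - f x\<close> survive in \<open>r\<close>.\<close>
      have "symp (f (u m)) (f x) = symp (f (u m) - f x) (f x)" by (simp add: symp_simps)
      then have "r $ m = symp (P (c (u m))) (f (u m) - f x) - symp (f (u m) - f x) (f x) / d"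
        using d by (simp add: r_def \<phi>_def g_def symp_simps field_simps)
      also have "\<bar>\<dots>\<bar> \<le> \<bar>symp (P (c (u m))) (f (u m) - f x)\<bar> + \<bar>symp (f (u m) - f x) (f x)\<bar> / d"
        using d abs_triangle_ineq4[of "symp (P (c (u m))) (f (u m) - f x)" "symp (f (u m) - f x) (f x) / d"] by simp
      also have "\<bar>symp (P (c (u m))) (f (u m) - f x)\<bar> \<le> n * (M * \<eta>)"
        using abs_symp_le[of "P (c (u m))" "f (u m) - f x"] P[OF cu] \<eta>[of m] M0 unfolding n_def
        by (elim order_trans) (intro mult_left_mono mult_mono; simp)
      also have "\<bar>symp (f (u m) - f x) (f x)\<bar> \<le> n * (\<eta> * B)"
        using abs_symp_le[of "f (u m) - f x" "f x"] B[of i j] \<eta>[of m] \<eta>0 unfolding n_def x_def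
        by (elim order_trans) (intro mult_left_mono mult_mono; simp)
      finally show ?thesis using d by (simp add: field_simps divide_right_mono)
    qed
    then have "(\<Sum>m\<in>UNIV. \<bar>r $ m\<bar>) \<le> (\<Sum>m\<in>(UNIV :: 4 set). n * ((M + B / d) * \<eta>))"
      by (intro sum_mono)
    then have "norm r \<le> 4 * (n * ((M + B / d) * \<eta>))"
      using norm_le_l1_cart[of r] by simp
    then have "norm Q \<le> \<epsilon>"
      using Q(2) \<eta>K mult_left_mono[OF _ K] unfolding n_def by (meson order_trans)
    moreover have "symp (g (u m)) (f x + Q) = \<phi> (u m) + symp (f x) Q" for m
    proof -
      have "g (u m) = f x + d *\<^sub>R w m" using d by (simp add: g_def w_def algebra_simps)
      then have "symp (g (u m)) Q = symp (f x) Q + d * r $ m" using Q(1) by (simp add: symp_simps)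
      moreover have "d * r $ m = \<phi> (u m) - symp (g (u m)) (f x)" using d by (simp add: r_def)
      ultimately show ?thesis by (simp add: symp_simps)
    qed
    ultimately show "\<exists>T k. norm (T - f (V i j)) \<le> \<epsilon> \<and> (\<forall>m. symp (g (nbr i j m)) T = \<phi> (nbr i j m) + k)"
      unfolding u_def x_def by (intro exI[of _ "f (V i j) + Q"] exI[of _ "symp (f (V i j)) Q"]) auto
  qed
qed

end

text \<open>The order of choices makes \<open>\<eta>\<close> uniform: \<open>P\<close>,
  \<open>e\<close>, \<open>K\<close> come first, then \<open>d\<close> from
  \<open>\<epsilon>\<close>, then \<open>\<eta>\<close> from \<open>d\<close> and \<open>B\<close>,
  all before \<open>V\<close> and \<open>f\<close> are given.\<close>

proposition isotropic_approximation:
  assumes n: "CARD('n) \<ge> 2" and \<epsilon>: "\<epsilon> > 0"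
  shows "\<exists>\<eta>>0. \<forall>V (f :: 'a \<Rightarrow> complex ^ 'n). checkerboard V \<longrightarrow> (\<forall>i j. norm (f (V i j)) \<le> B) \<longrightarrow>
     (\<forall>i j. norm (f (V (i + 1) j) - f (V i j)) \<le> \<eta> \<and> norm (f (V i (j + 1)) - f (V i j)) \<le> \<eta>) \<longrightarrow>
     (\<exists>\<tau>. (\<forall>i j. norm (\<tau> (V i j) - f (V i j)) \<le> \<epsilon>) \<and>
     (\<forall>i j. symp (\<tau> (V (i + 1) (j + 1)) - \<tau> (V i j)) (\<tau> (V i (j + 1)) - \<tau> (V (i + 1) j)) = 0))"
proof -
  obtain P :: "nat \<Rightarrow> complex ^ 'n" and e K where PeK: "e > 0" "K \<ge> 0"
    and solve: "\<And>(k :: 4 \<Rightarrow> nat) w r. inj k \<Longrightarrow> (\<And>i. k i \<le> 25 \<and> norm (w i - P (k i)) \<le> e) \<Longrightarrow>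
       (\<exists>x. (\<forall>i. symp (w i) x = r $ i) \<and> norm x \<le> K * norm r)"
    using symplectic_solve_uniform[OF n, of 25] by metis
  define M where "M = (\<Sum>k\<le>25. norm (P k)) + 1"
  have M0: "M > 0" unfolding M_def by (intro add_nonneg_pos sum_nonneg) auto
  have M: "norm (P k) \<le> M" if "k \<le> 25" for k
    using member_le_sum[of k "{..25}" "\<lambda>k. norm (P k)"] that by (simp add: M_def)
  define d where "d = \<epsilon> / M"
  have d: "d > 0" "d * M \<le> \<epsilon>" using M0 \<epsilon> by (simp_all add: d_def)
  \<comment> \<open>\<open>B\<close> is an arbitrary real here, so the absolute value and the 1
    ensure that \<open>D\<close> is positive.\<close>
  define D where "D = \<bar>K * (4 * (real CARD('n) * (M + B / d)))\<bar> + 1"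
  have D: "D > 0" "K * (4 * (real CARD('n) * (M + B / d))) \<le> D"
    unfolding D_def by (simp, metis abs_ge_self add_increasing2 zero_le_one)
  define \<eta> where "\<eta> = min (e * d) (\<epsilon> / D)"
  have \<eta>: "\<eta> > 0" using PeK d \<epsilon> D by (simp add: \<eta>_def)
  have "K * (4 * (real CARD('n) * ((M + B / d) * \<eta>))) = (K * (4 * (real CARD('n) * (M + B / d)))) * \<eta>"
    by simp
  also have "\<dots> \<le> D * \<eta>" using \<eta> D(2) by (intro mult_right_mono) auto
  also have "\<dots> \<le> \<epsilon>" using D by (simp add: \<eta>_def min_def field_simps)
  finally have \<eta>K: "K * (4 * (real CARD('n) * ((M + B / d) * \<eta>))) \<le> \<epsilon>" .
  show ?thesis
  proof (intro exI[of _ \<eta>] conjI allI impI)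
    fix V :: "int \<Rightarrow> int \<Rightarrow> 'a" and f :: "'a \<Rightarrow> complex ^ 'n"
    assume V: "checkerboard V" and B: "\<forall>i j. norm (f (V i j)) \<le> B"
      and c: "\<forall>i j. norm (f (V (i + 1) j) - f (V i j)) \<le> \<eta> \<and> norm (f (V i (j + 1)) - f (V i j)) \<le> \<eta>"
    interpret checkerboard V by (rule V)
    have "norm (f (nbr i j m) - f (V i j)) \<le> \<eta>" for i j m
      using c[rule_format, of i j] c[rule_format, of "i - 1" j] c[rule_format, of i "j - 1"]
      by (auto simp: nbr_def shift_def norm_minus_commute)
    then show "\<exists>\<tau>. (\<forall>i j. norm (\<tau> (V i j) - f (V i j)) \<le> \<epsilon>) \<and>
      (\<forall>i j. symp (\<tau> (V (i + 1) (j + 1)) - \<tau> (V i j)) (\<tau> (V i (j + 1)) - \<tau> (V (i + 1) j)) = 0)"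
      by (intro isotropic_approximation_step[OF solve PeK(2) d(1) M _ _ d(2) _ \<eta>K])
        (use B in \<open>auto simp: \<eta>_def\<close>)
  qed (rule \<eta>)
qed

section \<open>Coverings and planar lattices\<close>

text \<open>An evenly covered open set and its image under \<open>h\<close> have the same
  sheets.\<close>

lemma covering_space_compose_homeomorphism:
  assumes cov: "covering_space C p S" and hom: "homeomorphism S T h h'"
  shows "covering_space C (h \<circ> p) T"
proof
  have pC: "p ` C = S" using cov by (rule covering_space_imp_surjective)
  show "continuous_on C (h \<circ> p)"
    using cov hom pC by (metis continuous_on_compose covering_space_imp_continuous homeomorphism_cont1)
  show "(h \<circ> p) ` C = T"
    using pC homeomorphism_image1[OF hom] by (metis image_comp)
  fix t assume t: "t \<in> T"
  then have "h' t \<in> S" using hom by (metis homeomorphism_image2 imageI)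
  then obtain U v where U: "h' t \<in> U" "openin (top_of_set S) U" "\<Union>v = C \<inter> p -` U"
    "\<forall>u\<in>v. openin (top_of_set C) u" "pairwise disjnt v" "\<forall>u\<in>v. \<exists>q. homeomorphism u U p q"
    using cov unfolding covering_space_def by metis
  have US: "U \<subseteq> S" using U(2) openin_imp_subset by blast
  have inj: "h z \<in> h ` U \<longleftrightarrow> z \<in> U" if "z \<in> S" for z
    using US that homeomorphism_apply1[OF hom] by (metis image_iff subsetD)
  have hU: "homeomorphism U (h ` U) h h'"
    by (rule homeomorphism_of_subsets[OF hom US]) (use hom US in \<open>auto simp: homeomorphism_def\<close>)
  show "\<exists>U. t \<in> U \<and> openin (top_of_set T) U \<and>
          (\<exists>v. \<Union>v = C \<inter> (h \<circ> p) -` U \<and> (\<forall>u\<in>v. openin (top_of_set C) u) \<and>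
            pairwise disjnt v \<and> (\<forall>u\<in>v. \<exists>q. homeomorphism u U (h \<circ> p) q))"
  proof (intro exI conjI)
    show "t \<in> h ` U" using U(1) t homeomorphism_apply2[OF hom] by (metis imageI)
    show "openin (top_of_set T) (h ` U)" using hom U(2) by (rule homeomorphism_imp_open_map)
    show "\<Union>v = C \<inter> (h \<circ> p) -` (h ` U)" using U(3) inj pC by fastforce
    show "\<forall>u\<in>v. \<exists>q. homeomorphism u (h ` U) (h \<circ> p) q"
      using U(6) hU homeomorphism_compose by blast
  qed (use U in auto)
qed

text \<open>The homeomorphism \<open>h\<close> is there because the lifting theorems of the library require the base of
  the covering to lie in a normed space.\<close>

lemma deck_transformation_transitive:
  fixes p :: "'b::euclidean_space \<Rightarrow> 'a::topological_space" and h :: "'a \<Rightarrow> 'c::real_normed_vector"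
  assumes cov: "covering_space UNIV p S" and hom: "homeomorphism S T h h'" and xy: "p x = p y"
  shows "\<exists>D\<in>deck_transformations p. D x = y"
proof -
  define q where "q = h \<circ> p"
  have covq: "covering_space UNIV q T"
    unfolding q_def by (rule covering_space_compose_homeomorphism[OF cov hom])
  have pq: "p a = p b \<longleftrightarrow> q a = q b" for a b
    using covering_space_imp_surjective[OF cov] homeomorphism_apply1[OF hom]
    unfolding q_def by (metis comp_apply rangeI)
  have cq: "continuous_on UNIV q" "q \<in> UNIV \<rightarrow> T"
    using covq covering_space_imp_continuous covering_space_imp_surjective by blast+
  \<comment> \<open>The domain is simply connected and locally path connected, so \<open>q\<close>
    lifts through itself with a prescribed value at one point.\<close>
  have lift: "\<exists>g. continuous_on UNIV g \<and> g a = b \<and> (\<forall>z. q (g z) = q z)" if "q a = q b" for a b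
    using covering_space_lift_strong[OF covq _ _ _ _ cq that]
      convex_imp_simply_connected[OF convex_UNIV] convex_imp_locally_path_connected[OF convex_UNIV] by (metis UNIV_I)
  obtain g where g: "continuous_on UNIV g" "g x = y" "\<And>z. q (g z) = q z" using lift xy pq by metis
  obtain k where k: "continuous_on UNIV k" "k y = x" "\<And>z. q (k z) = q z" using lift[of y x] xy pq by metis
  \<comment> \<open>The composite of two such lifts is a lift of \<open>q\<close> that agrees with
    the identity at \<open>a\<close>, so uniqueness of lifts makes it the identity.\<close>
  have inverse: "f2 (f1 z) = z"
    if f: "continuous_on UNIV f1" "continuous_on UNIV f2" "f2 (f1 a) = a" "\<And>z. q (f1 z) = q z" "\<And>z. q (f2 z) = q z"
    for f1 f2 a z
  proof -
    have comp: "continuous_on UNIV (\<lambda>z. f2 (f1 z))"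
      by (rule continuous_on_compose2[OF f(2,1)]) simp
    show ?thesis
      by (rule covering_space_lift_unique[OF covq, of "\<lambda>z. f2 (f1 z)" a "\<lambda>z. z" UNIV q z])
        (use cq comp in \<open>simp_all add: f(3,4,5) connected_UNIV\<close>)
  qed
  have "k (g z) = z" "g (k z) = z" for z
    using inverse[OF g(1) k(1) _ g(3) k(3), of x z] inverse[OF k(1) g(1) _ k(3) g(3), of y z] g(2) k(2) by simp_all
  then have "homeomorphism UNIV UNIV g k"
    by (intro homeomorphismI g(1) k(1)) simp_all
  moreover have "p \<circ> g = p" using g(3) pq by auto
  ultimately show ?thesis using g(2) unfolding deck_transformations_def by blast
qed

section \<open>Determinants, planar lattices and periodic functions\<close>

definition det2 :: "real ^ 2 \<Rightarrow> real ^ 2 \<Rightarrow> real" where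
  "det2 x y = x $ 1 * y $ 2 - x $ 2 * y $ 1"

lemma det2_simps:
  "det2 (x + x') y = det2 x y + det2 x' y" "det2 y (x + x') = det2 y x + det2 y x'"
  "det2 (x - x') y = det2 x y - det2 x' y" "det2 y (x - x') = det2 y x - det2 y x'"
  "det2 (c *\<^sub>R x) y = c * det2 x y" "det2 y (c *\<^sub>R x) = c * det2 y x" "det2 x x = 0"
  by (simp_all add: det2_def algebra_simps)

lemma abs_det2_le: "\<bar>det2 x y\<bar> \<le> 2 * (norm x * norm y)"
proof -
  have "\<bar>det2 x y\<bar> \<le> \<bar>x $ 1\<bar> * \<bar>y $ 2\<bar> + \<bar>x $ 2\<bar> * \<bar>y $ 1\<bar>"
    unfolding det2_def using abs_triangle_ineq4[of "x $ 1 * y $ 2" "x $ 2 * y $ 1"] by (simp add: abs_mult)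
  also have "\<dots> \<le> norm x * norm y + norm x * norm y"
    by (intro add_mono mult_mono component_le_norm_cart) auto
  finally show ?thesis by simp
qed

text \<open>Cramer's rule.\<close>

lemma det2_expand:
  assumes "det2 a b \<noteq> 0"
  shows "x = (det2 x b / det2 a b) *\<^sub>R a + (det2 a x / det2 a b) *\<^sub>R b"
proof -
  have "det2 a b *\<^sub>R x = det2 x b *\<^sub>R a + det2 a x *\<^sub>R b"
    by (simp add: vec_eq_iff forall_2 det2_def algebra_simps)
  then have "(1 / det2 a b) *\<^sub>R (det2 a b *\<^sub>R x) = (1 / det2 a b) *\<^sub>R (det2 x b *\<^sub>R a + det2 a x *\<^sub>R b)"
    by simp
  then show ?thesis using assms by (simp add: scaleR_add_right)
qed

text \<open>The map takes Cramer coordinates in the basis \<open>a'\<close>, \<open>b'\<close> and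
  uses them as coefficients of \<open>a\<close>, \<open>b\<close>; linearity leaves no other choice,
  which resolves the definite description.\<close>

lemma basis_change_eq:
  assumes "det2 a' b' \<noteq> 0"
  shows "basis_change a b a' b' x = (det2 x b' / det2 a' b') *\<^sub>R a + (det2 a' x / det2 a' b') *\<^sub>R b"
proof -
  define U where "U x = (det2 x b' / det2 a' b') *\<^sub>R a + (det2 a' x / det2 a' b') *\<^sub>R b" for x
  have "basis_change a b a' b' = U"
    unfolding basis_change_def
  proof (rule the_equality, intro conjI)
    show "linear U"
      by (auto simp: linear_iff U_def det2_simps add_divide_distrib algebra_simps)
    show "U a' = a" "U b' = b" using assms by (simp_all add: U_def det2_simps)
    fix W assume W: "linear W \<and> W a' = a \<and> W b' = b"
    show "W = U"
    proof
      fix x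
      have "W x = W ((det2 x b' / det2 a' b') *\<^sub>R a' + (det2 a' x / det2 a' b') *\<^sub>R b')"
        using det2_expand[OF assms, of x] by simp
      then show "W x = U x" using W by (simp add: U_def linear_add linear_cmul)
    qed
  qed
  then show ?thesis by (simp add: U_def)
qed

lemma lattice_span_mem_iff:
  assumes "det2 a b \<noteq> 0"
  shows "s *\<^sub>R a + t *\<^sub>R b \<in> lattice_span a b \<longleftrightarrow> s \<in> \<int> \<and> t \<in> \<int>"
proof
  assume "s *\<^sub>R a + t *\<^sub>R b \<in> lattice_span a b"
  then obtain i j :: int where ij: "s *\<^sub>R a + t *\<^sub>R b = of_int i *\<^sub>R a + of_int j *\<^sub>R b"
    unfolding lattice_span_def by blast
  have "s * det2 a b = of_int i * det2 a b"
    using arg_cong[OF ij, of "\<lambda>x. det2 x b"] by (simp add: det2_simps)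
  moreover have "t * det2 a b = of_int j * det2 a b"
    using arg_cong[OF ij, of "\<lambda>x. det2 a x"] by (simp add: det2_simps)
  ultimately show "s \<in> \<int> \<and> t \<in> \<int>" using assms by simp
qed (auto simp: lattice_span_def elim!: Ints_cases)

lemma grid_ch_dense:
  assumes "N \<ge> 1"
  shows "\<exists>y\<in>grid_ch N. dist y x \<le> 4 / real N"
proof -
  \<comment> \<open>\<open>u\<close> and \<open>v\<close> are the coordinates of \<open>x\<close> in
    the checkerboard basis. Rounding them down moves \<open>x\<close> by at most one basis vector in
    each direction, of length at most \<open>2 / N\<close>.\<close>
  define u where "u = real N * (x $ 1 + x $ 2) / 2"
  define v where "v = real N * (x $ 2 - x $ 1) / 2"
  define y where "y = of_int \<lfloor>u\<rfloor> *\<^sub>R ((e1 + e2) /\<^sub>R real N) + of_int \<lfloor>v\<rfloor> *\<^sub>R ((e2 - e1) /\<^sub>R real N)"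
  have y: "y \<in> grid_ch N" unfolding y_def grid_ch_def lattice_span_def by blast
  have "x = u *\<^sub>R ((e1 + e2) /\<^sub>R real N) + v *\<^sub>R ((e2 - e1) /\<^sub>R real N)"
    using assms by (simp add: vec_eq_iff forall_2 u_def v_def axis_def field_simps)
  then have "y - x = (of_int \<lfloor>u\<rfloor> - u) *\<^sub>R ((e1 + e2) /\<^sub>R real N) + (of_int \<lfloor>v\<rfloor> - v) *\<^sub>R ((e2 - e1) /\<^sub>R real N)"
    by (simp add: y_def algebra_simps)
  then have "norm (y - x) \<le> norm ((of_int \<lfloor>u\<rfloor> - u) *\<^sub>R ((e1 + e2) /\<^sub>R real N)) + norm ((of_int \<lfloor>v\<rfloor> - v) *\<^sub>R ((e2 - e1) /\<^sub>R real N))"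
    by (metis norm_triangle_ineq)
  also have "\<dots> = \<bar>of_int \<lfloor>u\<rfloor> - u\<bar> * (norm (e1 + e2) / real N) + \<bar>of_int \<lfloor>v\<rfloor> - v\<bar> * (norm (e2 - e1) / real N)"
    by (simp only: norm_scaleR abs_inverse abs_of_nat divide_inverse mult.commute)
  also have "\<dots> \<le> 1 * (2 / real N) + 1 * (2 / real N)"
  proof -
    have "norm (e1 + e2) \<le> 2" "norm (e2 - e1) \<le> 2"
      using norm_triangle_ineq[of e1 e2] norm_triangle_ineq4[of e2 e1] by simp_all
    moreover have "\<bar>of_int \<lfloor>u\<rfloor> - u\<bar> \<le> 1" "\<bar>of_int \<lfloor>v\<rfloor> - v\<bar> \<le> 1" by linarith+
    ultimately show ?thesis by (intro add_mono mult_mono divide_right_mono) simp_all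
  qed
  finally have "dist y x \<le> 4 / real N" by (simp add: dist_norm)
  with y show ?thesis by blast
qed

lemma nearest_grid_ch_tendsto:
  assumes "\<And>N. N \<ge> 1 \<Longrightarrow> is_arg_min (\<lambda>y. dist y \<gamma>) (\<lambda>y. y \<in> grid_ch N) (\<gamma>N N)"
  shows "\<gamma>N \<longlonglongrightarrow> \<gamma>"
proof -
  have "norm (\<gamma>N N - \<gamma>) \<le> 4 / real N" if N: "N \<ge> 1" for N
  proof -
    obtain y where y: "y \<in> grid_ch N" "dist y \<gamma> \<le> 4 / real N" using grid_ch_dense[OF N] by blast
    then have "dist (\<gamma>N N) \<gamma> \<le> dist y \<gamma>"
      using assms[OF N] unfolding is_arg_min_def by (meson not_le)
    then show ?thesis using y(2) by (simp add: dist_norm)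
  qed
  then have "\<forall>\<^sub>F N in sequentially. norm (\<gamma>N N - \<gamma>) \<le> 4 / real N"
    unfolding eventually_sequentially by blast
  then have "(\<lambda>N. \<gamma>N N - \<gamma>) \<longlonglongrightarrow> 0"
    by (rule Lim_null_comparison) (rule lim_const_over_n)
  then show ?thesis by (rule LIM_zero_cancel)
qed

text \<open>Periodicity reduces both claims to a compact square. For uniform continuity,
  \<open>red z z'\<close> translates \<open>z'\<close> by the integer parts of \<open>z\<close>, so
  that two nearby points are moved by the same vector and their distance is kept.\<close>

lemma periodic_continuous:
  fixes H :: "real \<times> real \<Rightarrow> 'b::metric_space"
  assumes cont: "continuous_on UNIV H" and per: "\<And>s t m n. H (s + of_int m, t + of_int n) = H (s, t)"
  shows "bounded (range H)" "uniformly_continuous_on UNIV H"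
proof -
  \<comment> \<open>The unit square is enlarged by 1 on every side, to contain also the translates
    of points within distance 1 of \<open>z\<close>.\<close>
  define K where "K = {-1..2::real} \<times> {-1..2::real}"
  have K: "compact K" unfolding K_def by (intro compact_Times) auto
  have cK: "continuous_on K H" using cont continuous_on_subset by blast
  define red where "red z z' = (fst z' - of_int \<lfloor>fst z\<rfloor>, snd z' - of_int \<lfloor>snd z\<rfloor>)" for z z' :: "real \<times> real"
  have red: "H (red z z') = H z'" for z z'
    using per[of "fst z'" "- \<lfloor>fst z\<rfloor>" "snd z'" "- \<lfloor>snd z\<rfloor>"] by (simp add: red_def)
  have redK: "red z z' \<in> K" if "dist z z' < 1" for z z'
  proof -
    have "\<bar>fst z - fst z'\<bar> < 1" "\<bar>snd z - snd z'\<bar> < 1"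
      using that dist_fst_le[of z z'] dist_snd_le[of z z'] by (auto simp: dist_real_def)
    then show ?thesis unfolding K_def red_def by simp linarith
  qed
  have "H z \<in> H ` K" for z using red[of z z] redK[of z z] by (metis dist_self imageI zero_less_one)
  then have "range H \<subseteq> H ` K" by blast
  then show "bounded (range H)"
    using compact_continuous_image[OF cK K] compact_imp_bounded bounded_subset by blast
  have u: "uniformly_continuous_on K H" using cK K by (rule compact_uniformly_continuous)
  show "uniformly_continuous_on UNIV H"
    unfolding uniformly_continuous_on_def
  proof (intro allI impI)
    fix e :: real assume "e > 0"
    then obtain d where d: "d > 0" "\<And>z z'. z \<in> K \<Longrightarrow> z' \<in> K \<Longrightarrow> dist z' z < d \<Longrightarrow> dist (H z') (H z) < e"
      using u unfolding uniformly_continuous_on_def by metis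
    have "dist (H z') (H z) < e" if "dist z' z < min d 1" for z z'
    proof -
      have "dist (red z z') (red z z) = dist z' z"
        by (simp add: red_def dist_prod_def dist_real_def)
      then show ?thesis
        using d(2)[of "red z z" "red z z'"] redK[of z z] redK[of z z'] red that by (simp add: dist_commute)
    qed
    then show "\<exists>d>0. \<forall>x\<in>UNIV. \<forall>x'\<in>UNIV. dist x' x < d \<longrightarrow> dist (H x') (H x) < e"
      using d(1) by (intro exI[of _ "min d 1"]) auto
  qed
qed

text \<open>For each \<open>N\<close> the best tolerance \<open>1 / Suc k\<close> attainable with
  \<open>k \<le> N\<close> is used. The bound on \<open>k\<close> keeps \<open>S N\<close> finite;
  every fixed \<open>k\<close> with \<open>1 / Suc k < \<epsilon>\<close> eventually lies in
  \<open>S N\<close>, and the maximum is then at least \<open>k\<close>.\<close>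

lemma diagonal_choice:
  fixes Q :: "nat \<Rightarrow> 'a \<Rightarrow> real \<Rightarrow> bool"
  assumes ex: "\<And>\<epsilon>. \<epsilon> > 0 \<Longrightarrow> \<exists>N0. \<forall>N\<ge>N0. \<exists>\<tau>. Q N \<tau> \<epsilon>"
    and mono: "\<And>N \<tau> \<epsilon> \<epsilon>'. Q N \<tau> \<epsilon> \<Longrightarrow> \<epsilon> \<le> \<epsilon>' \<Longrightarrow> Q N \<tau> \<epsilon>'"
  shows "\<exists>\<rho>. \<forall>\<epsilon>>0. \<exists>N0>0. \<forall>N\<ge>N0. Q N (\<rho> N) \<epsilon>"
proof -
  define S where "S N = {k. k \<le> N \<and> (\<exists>\<tau>. Q N \<tau> (1 / real (Suc k)))}" for N
  define \<rho> where "\<rho> N = (SOME \<tau>. Q N \<tau> (1 / real (Suc (Max (S N)))))" for N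
  have fin: "finite (S N)" for N by (rule finite_subset[of _ "{..N}"]) (auto simp: S_def)
  have "\<exists>N0>0. \<forall>N\<ge>N0. Q N (\<rho> N) \<epsilon>" if \<epsilon>: "\<epsilon> > 0" for \<epsilon>
  proof -
    obtain k where k: "1 / real (Suc k) < \<epsilon>" using \<epsilon> by (metis nat_approx_posE)
    obtain M where M: "\<And>N. N \<ge> M \<Longrightarrow> \<exists>\<tau>. Q N \<tau> (1 / real (Suc k))"
      using ex[of "1 / real (Suc k)"] by auto
    have "Q N (\<rho> N) \<epsilon>" if N: "N \<ge> max 1 (max M k)" for N
    proof -
      have kS: "k \<in> S N" using N M by (simp add: S_def)
      then have "Max (S N) \<in> S N" using fin by (metis Max_in empty_iff)
      then have "Q N (\<rho> N) (1 / real (Suc (Max (S N))))"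
        unfolding \<rho>_def by (intro someI_ex[of "\<lambda>\<tau>. Q N \<tau> _"]) (simp add: S_def)
      moreover have "1 / real (Suc (Max (S N))) \<le> 1 / real (Suc k)"
        using Max_ge[OF fin kS] by (intro divide_left_mono) auto
      ultimately show ?thesis using mono k by (meson less_imp_le order_trans)
    qed
    then show ?thesis by (intro exI[of _ "max 1 (max M k)"]) auto
  qed
  then show ?thesis by blast
qed

section \<open>The quadrangulated torus\<close>

definition gridpt :: "nat \<Rightarrow> int \<Rightarrow> int \<Rightarrow> real ^ 2" where
  "gridpt N i j = of_int i *\<^sub>R (e1 /\<^sub>R real N) + of_int j *\<^sub>R (e2 /\<^sub>R real N)"

lemma gridpt_nth [simp]: "gridpt N i j $ 1 = of_int i / real N" "gridpt N i j $ 2 = of_int j / real N"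
  by (simp_all add: gridpt_def axis_def divide_inverse)

lemma gridpt_diff: "gridpt N i j - gridpt N i' j' = gridpt N (i - i') (j - j')"
  by (simp add: vec_eq_iff forall_2 diff_divide_distrib)

lemma grid_eq: "grid N = {gridpt N i j | i j. True}"
  by (simp add: grid_def lattice_span_def gridpt_def)

lemma gridpt_steps:
  assumes "N \<ge> 1"
  shows "gridpt N i j + e1 /\<^sub>R real N = gridpt N (i + 1) j"
    "gridpt N i j + (e1 + e2) /\<^sub>R real N = gridpt N (i + 1) (j + 1)"
    "gridpt N i j + e2 /\<^sub>R real N = gridpt N i (j + 1)"
  using assms by (simp_all add: vec_eq_iff forall_2 axis_def field_simps)

lemma norm_gridpt_le: "norm (gridpt N i j) \<le> (\<bar>of_int i\<bar> + \<bar>of_int j\<bar>) / real N"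
  using norm_le_l1_cart[of "gridpt N i j"] by (simp add: UNIV_2 add_divide_distrib)

text \<open>In units of \<open>1 / N\<close>, the coordinate sums of the two checkerboard generators
  are 2 and 0.\<close>

lemma gridpt_grid_ch_even:
  assumes "N \<ge> 1" "gridpt N i j = of_int m *\<^sub>R a + of_int n *\<^sub>R b" "a \<in> grid_ch N" "b \<in> grid_ch N"
  shows "even (i + j)"
proof -
  obtain k l k' l' :: int where kl:
    "a = of_int k *\<^sub>R ((e1 + e2) /\<^sub>R real N) + of_int l *\<^sub>R ((e2 - e1) /\<^sub>R real N)"
    "b = of_int k' *\<^sub>R ((e1 + e2) /\<^sub>R real N) + of_int l' *\<^sub>R ((e2 - e1) /\<^sub>R real N)"
    using assms(3,4) unfolding grid_ch_def lattice_span_def by blast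
  have "real_of_int (i + j) / real N = (gridpt N i j) $ 1 + (gridpt N i j) $ 2"
    by (simp add: add_divide_distrib)
  also have "\<dots> = real_of_int (2 * (m * k + n * k')) / real N"
    unfolding assms(2) kl by (simp add: axis_def divide_inverse algebra_simps)
  finally have "real_of_int (i + j) = real_of_int (2 * (m * k + n * k'))"
    using assms(1) by simp
  then have "i + j = 2 * (m * k + n * k')" using of_int_eq_iff by blast
  then show ?thesis by simp
qed

text \<open>Two grid points are identified when their difference has integer coordinates in the
  basis \<open>a'\<close>, \<open>b'\<close>. If the index differences are at most 2, its norm is at
  most \<open>4 / N\<close>, so these integers have absolute value below 1 and vanish.\<close>

lemma checkerboard_gridpt:
  assumes N: "N \<ge> 1" and D: "det2 a' b' \<noteq> 0" and ch: "a' \<in> grid_ch N" "b' \<in> grid_ch N"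
    and bnd: "\<And>x. \<bar>det2 x b' / det2 a' b'\<bar> \<le> C * norm x" "\<And>x. \<bar>det2 a' x / det2 a' b'\<bar> \<le> C * norm x"
    and NC: "C * (4 / real N) < 1"
    and q: "\<And>x y. q x = q y \<longleftrightarrow> det2 (x - y) b' / det2 a' b' \<in> \<int> \<and> det2 a' (x - y) / det2 a' b' \<in> \<int>"
  shows "checkerboard (\<lambda>i j. q (gridpt N i j))"
proof -
  have C: "C \<ge> 0"
  proof -
    have "0 \<le> C * norm e1" using bnd(1)[of e1] abs_ge_zero order_trans by blast
    then show ?thesis by simp
  qed
  define s where "s x = det2 x b' / det2 a' b'" for x
  define t where "t x = det2 a' x / det2 a' b'" for x
  have qV: "q (gridpt N i j) = q (gridpt N i' j') \<longleftrightarrow>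
      s (gridpt N (i - i') (j - j')) \<in> \<int> \<and> t (gridpt N (i - i') (j - j')) \<in> \<int>" for i j i' j'
    by (simp add: q s_def t_def gridpt_diff)
  have st: "x = s x *\<^sub>R a' + t x *\<^sub>R b'" for x
    unfolding s_def t_def using D by (rule det2_expand)
  show ?thesis
  proof
    fix i j i' j' a b
    assume eq: "q (gridpt N i j) = q (gridpt N i' j')"
    then show "q (gridpt N (i + a) (j + b)) = q (gridpt N (i' + a) (j' + b))"
      by (simp add: qV)
    obtain m n :: int where mn: "s (gridpt N (i - i') (j - j')) = of_int m" "t (gridpt N (i - i') (j - j')) = of_int n"
      using eq qV by (metis Ints_cases)
    have "even ((i - i') + (j - j'))"
      using gridpt_grid_ch_even[OF N _ ch, of "i - i'" "j - j'" m n] st[of "gridpt N (i - i') (j - j')"] mn by simp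
    then show "even (i + j) \<longleftrightarrow> even (i' + j')" by presburger
    assume le: "\<bar>i - i'\<bar> \<le> 2" "\<bar>j - j'\<bar> \<le> 2"
    have "norm (gridpt N (i - i') (j - j')) \<le> (\<bar>of_int (i - i')\<bar> + \<bar>of_int (j - j')\<bar>) / real N"
      by (rule norm_gridpt_le)
    also have "\<dots> \<le> 4 / real N"
    proof (rule divide_right_mono)
      have "\<bar>i - i'\<bar> + \<bar>j - j'\<bar> \<le> 4" using le by simp
      then show "\<bar>real_of_int (i - i')\<bar> + \<bar>real_of_int (j - j')\<bar> \<le> 4"
        by (metis of_int_abs of_int_add of_int_le_iff of_int_numeral)
    qed simp
    finally have "C * norm (gridpt N (i - i') (j - j')) < 1"
      using mult_left_mono[OF _ C] NC by (meson le_less_trans)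
    then have "\<bar>real_of_int m\<bar> < 1" "\<bar>real_of_int n\<bar> < 1"
      using bnd[of "gridpt N (i - i') (j - j')"] mn unfolding s_def t_def by linarith+
    then have "m = 0" "n = 0" by linarith+
    then have "gridpt N (i - i') (j - j') = 0" using st[of "gridpt N (i - i') (j - j')"] mn by simp
    then have "gridpt N (i - i') (j - j') $ 1 = 0" "gridpt N (i - i') (j - j') $ 2 = 0" by simp_all
    then show "i = i' \<and> j = j'" using N by simp
  qed
qed

text \<open>By Cramer's rule the coordinate functionals are uniformly bounded: eventually the
  determinants exceed half their limit and the basis vectors are shorter than
  \<open>R\<close>.\<close>

lemma dual_basis_bound:
  assumes a: "aN \<longlonglongrightarrow> a" and b: "bN \<longlonglongrightarrow> b" and D: "det2 a b > 0"
  shows "\<exists>C>0. \<forall>\<^sub>F N in sequentially. det2 (aN N) (bN N) > 0 \<and>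
    (\<forall>x. \<bar>det2 x (bN N) / det2 (aN N) (bN N)\<bar> \<le> C * norm x \<and>
         \<bar>det2 (aN N) x / det2 (aN N) (bN N)\<bar> \<le> C * norm x)"
proof -
  define R where "R = norm a + norm b + 1"
  define C where "C = 4 * R / det2 a b"
  have R: "R > 0" by (simp add: R_def add_nonneg_pos)
  have "(\<lambda>N. det2 (aN N) (bN N)) \<longlonglongrightarrow> det2 a b"
    unfolding det2_def by (intro tendsto_intros a b)
  then have "\<forall>\<^sub>F N in sequentially. det2 (aN N) (bN N) > det2 a b / 2"
    using D by (intro order_tendstoD(1)) auto
  moreover have "\<forall>\<^sub>F N in sequentially. norm (aN N) < R"
    using tendsto_norm[OF a] by (rule order_tendstoD(2)) (simp add: R_def add_nonneg_pos)
  moreover have "\<forall>\<^sub>F N in sequentially. norm (bN N) < R"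
    using tendsto_norm[OF b] by (rule order_tendstoD(2)) (simp add: R_def add_nonneg_pos)
  ultimately have "\<forall>\<^sub>F N in sequentially. det2 (aN N) (bN N) > 0 \<and>
    (\<forall>x. \<bar>det2 x (bN N) / det2 (aN N) (bN N)\<bar> \<le> C * norm x \<and>
         \<bar>det2 (aN N) x / det2 (aN N) (bN N)\<bar> \<le> C * norm x)"
  proof eventually_elim
    case (elim N)
    let ?d = "det2 (aN N) (bN N)"
    have d: "?d > 0" using elim D by linarith
    have *: "\<bar>y / ?d\<bar> \<le> C * norm x" if y: "\<bar>y\<bar> \<le> 2 * (norm x * R)" for y and x :: "real ^ 2"
    proof -
      have "\<bar>y / ?d\<bar> \<le> 2 * (norm x * R) / (det2 a b / 2)"
        unfolding abs_divide using y elim d D R by (intro frac_le) auto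
      then show ?thesis by (simp add: C_def algebra_simps)
    qed
    have "\<bar>det2 x (bN N)\<bar> \<le> 2 * (norm x * R)" for x
      by (rule order_trans[OF abs_det2_le]) (use elim in \<open>simp add: mult_left_mono\<close>)
    moreover have "\<bar>det2 (aN N) x\<bar> \<le> 2 * (norm x * R)" for x
      by (rule order_trans[OF abs_det2_le], subst mult.commute[of "norm (aN N)"])
        (use elim in \<open>simp add: mult_left_mono\<close>)
    ultimately show ?case using d * by blast
  qed
  moreover have "C > 0" using R D by (simp add: C_def)
  ultimately show ?thesis by blast
qed

text \<open>The diffeomorphism onto \<open>torus\<close> supplies the homeomorphism into a normed
  space for \<open>deck_transformation_transitive\<close>, so points of one fibre differ by a
  lattice vector.\<close>

lemma conformal_covering_fibre:
  fixes p :: "real ^ 2 \<Rightarrow> 'a::topological_space"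
  assumes dif: "diffeomorphic \<Sigma> A torus torus_atlas" and cov: "conformal_covering \<Sigma> A f p (lattice_span a b)"
    and D: "det2 a b \<noteq> 0"
  shows "p (s *\<^sub>R a + t *\<^sub>R b) = p (s' *\<^sub>R a + t' *\<^sub>R b) \<longleftrightarrow> s - s' \<in> \<int> \<and> t - t' \<in> \<int>"
proof -
  obtain h h' where "smooth_map \<Sigma> A torus torus_atlas h" "smooth_map torus torus_atlas \<Sigma> A h'"
    "\<forall>x\<in>\<Sigma>. h' (h x) = x" "\<forall>y\<in>torus. h (h' y) = y"
    using dif unfolding diffeomorphic_def by blast
  then have hom: "homeomorphism \<Sigma> torus h h'"
    unfolding smooth_map_def by (intro homeomorphismI) auto
  have cp: "covering_space UNIV p \<Sigma>"
    and deck: "deck_transformations p = {(\<lambda>x. x + \<gamma>) | \<gamma>. \<gamma> \<in> lattice_span a b}"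
    using cov unfolding conformal_covering_def by auto
  have "p x = p y \<longleftrightarrow> x - y \<in> lattice_span a b" for x y
  proof
    assume "p x = p y"
    then obtain T where "T \<in> deck_transformations p" "T y = x"
      using deck_transformation_transitive[OF cp hom, of y x] by auto
    then show "x - y \<in> lattice_span a b" unfolding deck by auto
  next
    assume "x - y \<in> lattice_span a b"
    then have "(\<lambda>z. z + (x - y)) \<in> deck_transformations p" unfolding deck by blast
    then have "p \<circ> (\<lambda>z. z + (x - y)) = p" unfolding deck_transformations_def by blast
    from fun_cong[OF this, of y] show "p x = p y" by simp
  qed
  moreover have "(s *\<^sub>R a + t *\<^sub>R b) - (s' *\<^sub>R a + t' *\<^sub>R b) = (s - s') *\<^sub>R a + (t - t') *\<^sub>R b"
    by (simp add: algebra_simps)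
  ultimately show ?thesis using lattice_span_mem_iff[OF D] by simp
qed

theorem theorem3:
  fixes \<Sigma> :: "'a::topological_space set"
    and A :: "('a, real ^ 2) chart set"
    and l :: "'a \<Rightarrow> complex ^ 'n"
    and p :: "real ^ 2 \<Rightarrow> 'a"
    and \<Gamma> :: "(real ^ 2) set"
    and \<gamma>1 \<gamma>2 :: "real ^ 2"
    and \<gamma>1N \<gamma>2N :: "nat \<Rightarrow> real ^ 2"
    and pN :: "nat \<Rightarrow> real ^ 2 \<Rightarrow> 'a"
  assumes "CARD('n) \<ge> 2"
    and "smooth_manifold \<Sigma> A" and "diffeomorphic \<Sigma> A torus torus_atlas"
    and "smooth_immersion \<Sigma> A l" and "isotropic_map A l"
    and "conformal_covering \<Sigma> A l p \<Gamma>"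
    and "oriented_basis_of \<Gamma> \<gamma>1 \<gamma>2"
    and "\<And>N. N \<ge> 1 \<Longrightarrow> is_arg_min (\<lambda>y. dist y \<gamma>1) (\<lambda>y. y \<in> grid_ch N) (\<gamma>1N N)"
    and "\<And>N. N \<ge> 1 \<Longrightarrow> is_arg_min (\<lambda>y. dist y \<gamma>2) (\<lambda>y. y \<in> grid_ch N) (\<gamma>2N N)"
    and "\<And>N. pN N = p \<circ> basis_change \<gamma>1 \<gamma>2 (\<gamma>1N N) (\<gamma>2N N)"
  shows "\<exists>(\<rho> :: nat \<Rightarrow> 'a \<Rightarrow> complex ^ 'n) N1.
           (\<forall>N\<ge>N1. \<rho> N \<in> quad_meshes N (pN N) \<and> isotropic_mesh N (pN N) (\<rho> N)) \<and>
           (\<forall>\<epsilon>>0. \<exists>N0>0. \<forall>N\<ge>N0. \<forall>v \<in> quad_vertices N (pN N). norm (\<rho> N v - l v) \<le> \<epsilon>)"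
proof -
  have \<Gamma>: "\<Gamma> = lattice_span \<gamma>1 \<gamma>2" and D: "det2 \<gamma>1 \<gamma>2 > 0"
    using assms(7) unfolding oriented_basis_of_def by (auto simp: det_2 det2_def algebra_simps)
  have cov: "conformal_covering \<Sigma> A l p (lattice_span \<gamma>1 \<gamma>2)" using assms(6) \<Gamma> by simp
  have fibre: "p (s *\<^sub>R \<gamma>1 + t *\<^sub>R \<gamma>2) = p (s' *\<^sub>R \<gamma>1 + t' *\<^sub>R \<gamma>2) \<longleftrightarrow> s - s' \<in> \<int> \<and> t - t' \<in> \<int>" for s t s' t'
    by (rule conformal_covering_fibre[OF assms(3) cov]) (use D in simp)

  \<comment> \<open>In coordinates of the basis \<open>\<gamma>1\<close>, \<open>\<gamma>2\<close>
    the lifted immersion is periodic under integer shifts. All meshes sample this one function, so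
    its bound \<open>B\<close> and modulus of continuity serve every \<open>N\<close>.\<close>
  define H where "H = (\<lambda>(s, t). l (p (s *\<^sub>R \<gamma>1 + t *\<^sub>R \<gamma>2)))"
  have "covering_space UNIV p \<Sigma>" using cov unfolding conformal_covering_def by blast
  then have p: "continuous_on UNIV p" "range p = \<Sigma>"
    using covering_space_imp_continuous covering_space_imp_surjective by blast+
  have cl: "continuous_on \<Sigma> l"
    using assms(4) unfolding smooth_immersion_def smooth_map_def by blast
  have "continuous_on UNIV (\<lambda>z. p (fst z *\<^sub>R \<gamma>1 + snd z *\<^sub>R \<gamma>2))"
    by (rule continuous_on_compose2[OF p(1)]) (auto intro!: continuous_intros)
  then have cH: "continuous_on UNIV H"
    unfolding H_def case_prod_unfold by (rule continuous_on_compose2[OF cl]) (use p(2) in auto)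
  have per: "H (s + of_int m, t + of_int n) = H (s, t)" for s t m n
  proof -
    have "p ((s + of_int m) *\<^sub>R \<gamma>1 + (t + of_int n) *\<^sub>R \<gamma>2) = p (s *\<^sub>R \<gamma>1 + t *\<^sub>R \<gamma>2)"
      unfolding fibre by simp
    then show ?thesis by (simp add: H_def)
  qed
  have uH: "uniformly_continuous_on UNIV H" using cH per by (rule periodic_continuous(2))
  have "bounded (range H)" using cH per by (rule periodic_continuous(1))
  then obtain B where B: "\<And>z. norm (H z) \<le> B" unfolding bounded_iff by blast

  obtain C where C: "C > 0" and evC: "\<forall>\<^sub>F N in sequentially. det2 (\<gamma>1N N) (\<gamma>2N N) > 0 \<and>
    (\<forall>x. \<bar>det2 x (\<gamma>2N N) / det2 (\<gamma>1N N) (\<gamma>2N N)\<bar> \<le> C * norm x \<and>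
         \<bar>det2 (\<gamma>1N N) x / det2 (\<gamma>1N N) (\<gamma>2N N)\<bar> \<le> C * norm x)"
    using dual_basis_bound[OF nearest_grid_ch_tendsto[OF assms(8)] nearest_grid_ch_tendsto[OF assms(9)] D] by blast

  define Q where "Q N \<tau> \<epsilon> \<longleftrightarrow> \<tau> \<in> quad_meshes N (pN N) \<and> isotropic_mesh N (pN N) \<tau> \<and>
      (\<forall>v\<in>quad_vertices N (pN N). norm (\<tau> v - l v) \<le> \<epsilon>)" for N and \<tau> :: "'a \<Rightarrow> complex ^ 'n" and \<epsilon>
  have "\<exists>\<rho>. \<forall>\<epsilon>>0. \<exists>N0>0. \<forall>N\<ge>N0. Q N (\<rho> N) \<epsilon>"
  proof (rule diagonal_choice)
    fix \<epsilon> :: real assume "\<epsilon> > 0"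
    from isotropic_approximation[OF assms(1) this, where B = B and ?'a = 'a]
    obtain \<eta> where \<eta>: "\<eta> > 0" and approx:
      "\<And>V (f :: 'a \<Rightarrow> complex ^ 'n). checkerboard V \<Longrightarrow> (\<forall>i j. norm (f (V i j)) \<le> B) \<Longrightarrow>
       (\<forall>i j. norm (f (V (i + 1) j) - f (V i j)) \<le> \<eta> \<and> norm (f (V i (j + 1)) - f (V i j)) \<le> \<eta>) \<Longrightarrow>
       (\<exists>\<tau>. (\<forall>i j. norm (\<tau> (V i j) - f (V i j)) \<le> \<epsilon>) \<and>
       (\<forall>i j. symp (\<tau> (V (i + 1) (j + 1)) - \<tau> (V i j)) (\<tau> (V i (j + 1)) - \<tau> (V (i + 1) j)) = 0))"
      by blast
    obtain d where d: "d > 0" "\<And>z z'. dist z' z < d \<Longrightarrow> dist (H z') (H z) < \<eta>"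
      using uH \<eta> unfolding uniformly_continuous_on_def by (metis UNIV_I)
    have lim: "(\<lambda>N. c / real N) \<longlonglongrightarrow> 0" for c by (rule lim_const_over_n)
    \<comment> \<open>The first condition excludes short identifications; the second bounds the
      change of the coordinates \<open>(s, t)\<close> along an edge, at most \<open>C / N\<close> in
      each.\<close>
    have "\<forall>\<^sub>F N in sequentially. C * 4 / real N < 1" "\<forall>\<^sub>F N in sequentially. 2 * C / real N < d"
      using order_tendstoD(2)[OF lim] d(1) by auto
    then have "\<forall>\<^sub>F N in sequentially. \<exists>\<tau>. Q N \<tau> \<epsilon>"
      using evC eventually_ge_at_top[of "1 :: nat"]
    proof eventually_elim
      case (elim N)
      define s where "s x = det2 x (\<gamma>2N N) / det2 (\<gamma>1N N) (\<gamma>2N N)" for x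
      define t where "t x = det2 (\<gamma>1N N) x / det2 (\<gamma>1N N) (\<gamma>2N N)" for x
      define V where "V i j = pN N (gridpt N i j)" for i j
      have N: "N \<ge> 1" and dN: "det2 (\<gamma>1N N) (\<gamma>2N N) \<noteq> 0" using elim by auto
      have st: "s (x - y) = s x - s y" "t (x - y) = t x - t y" for x y
        by (simp_all add: s_def t_def det2_simps diff_divide_distrib)
      \<comment> \<open>\<open>basis_change\<close> preserves coordinates, so \<open>pN N\<close> is
        \<open>p\<close> at the point with the same coordinates in the fixed basis.\<close>
      have pN: "pN N x = p (s x *\<^sub>R \<gamma>1 + t x *\<^sub>R \<gamma>2)" for x
        by (simp add: assms(10) basis_change_eq[OF dN] s_def t_def)
      have "\<gamma>1N N \<in> grid_ch N" "\<gamma>2N N \<in> grid_ch N"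
        using assms(8,9)[OF N] unfolding is_arg_min_def by blast+
      moreover have "pN N x = pN N y \<longleftrightarrow> s (x - y) \<in> \<int> \<and> t (x - y) \<in> \<int>" for x y
        unfolding pN fibre st ..
      ultimately have V: "checkerboard V"
        unfolding V_def using elim N dN
        by (intro checkerboard_gridpt[where C = C]) (auto simp: s_def t_def)
      have lV: "l (V i j) = H (s (gridpt N i j), t (gridpt N i j))" for i j
        by (simp add: V_def pN H_def)
      have close: "norm (l (V i j) - l (V i' j')) \<le> \<eta>" if "\<bar>i - i'\<bar> + \<bar>j - j'\<bar> \<le> 1" for i j i' j'
      proof -
        have "norm (gridpt N (i - i') (j - j')) \<le> (\<bar>of_int (i - i')\<bar> + \<bar>of_int (j - j')\<bar>) / real N"
          by (rule norm_gridpt_le)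
        also have "\<dots> \<le> 1 / real N"
          using that by (intro divide_right_mono) (metis of_int_abs of_int_add of_int_le_1_iff, simp)
        finally have n: "C * norm (gridpt N (i - i') (j - j')) \<le> C / real N"
          using mult_left_mono[of _ "1 / real N" C] C by simp
        have "dist (s (gridpt N i j), t (gridpt N i j)) (s (gridpt N i' j'), t (gridpt N i' j'))
            \<le> \<bar>s (gridpt N i j) - s (gridpt N i' j')\<bar> + \<bar>t (gridpt N i j) - t (gridpt N i' j')\<bar>"
          unfolding dist_Pair_Pair dist_real_def by (rule sqrt_sum_squares_le_sum) simp_all
        also have "\<dots> = \<bar>s (gridpt N (i - i') (j - j'))\<bar> + \<bar>t (gridpt N (i - i') (j - j'))\<bar>"
          by (simp add: st gridpt_diff[symmetric])
        also have "\<dots> \<le> C / real N + C / real N"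
          using elim n unfolding s_def t_def by (intro add_mono) (blast intro: order_trans)+
        also have "\<dots> < d" using elim by simp
        finally show ?thesis unfolding lV using d(2) by (metis dist_norm less_imp_le)
      qed
      obtain \<tau> where \<tau>: "\<And>i j. norm (\<tau> (V i j) - l (V i j)) \<le> \<epsilon>"
        "\<And>i j. symp (\<tau> (V (i + 1) (j + 1)) - \<tau> (V i j)) (\<tau> (V i (j + 1)) - \<tau> (V (i + 1) j)) = 0"
        using approx[OF V, of l] B lV close by auto
      have vert: "quad_vertices N (pN N) = {V i j | i j. True}"
        by (auto simp: quad_vertices_def grid_eq V_def)
      have V_vert: "V i j \<in> quad_vertices N (pN N)" for i j unfolding vert by blast
      have faces: "quad_faces N (pN N) = {(V i j, V (i + 1) j, V (i + 1) (j + 1), V i (j + 1)) | i j. True}"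
        unfolding quad_faces_def grid_eq V_def by (force simp: gridpt_steps[OF N])
      \<comment> \<open>Meshes are extensional functions, so values off the vertices are
        discarded.\<close>
      have "Q N (restrict \<tau> (quad_vertices N (pN N))) \<epsilon>"
        unfolding Q_def
      proof (intro conjI)
        show "restrict \<tau> (quad_vertices N (pN N)) \<in> quad_meshes N (pN N)"
          unfolding quad_meshes_def by simp
        show "isotropic_mesh N (pN N) (restrict \<tau> (quad_vertices N (pN N)))"
          unfolding isotropic_mesh_iff faces using \<tau>(2) by (auto simp: V_vert)
        show "\<forall>v\<in>quad_vertices N (pN N). norm (restrict \<tau> (quad_vertices N (pN N)) v - l v) \<le> \<epsilon>"
          using \<tau>(1) unfolding vert by auto
      qed
      then show ?case by blast
    qed
    then show "\<exists>N0. \<forall>N\<ge>N0. \<exists>\<tau>. Q N \<tau> \<epsilon>" unfolding eventually_sequentially .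
  next
    show "Q N \<tau> \<epsilon>'" if "Q N \<tau> \<epsilon>" "\<epsilon> \<le> \<epsilon>'" for N \<tau> \<epsilon> \<epsilon>'
      using that unfolding Q_def by (meson order_trans)
  qed
  then obtain \<rho> where \<rho>: "\<And>\<epsilon>. \<epsilon> > 0 \<Longrightarrow> \<exists>N0>0. \<forall>N\<ge>N0. Q N (\<rho> N) \<epsilon>" by blast
  \<comment> \<open>Isotropy does not involve the tolerance, so the single value 1 provides the
    threshold \<open>N1\<close>.\<close>
  obtain N1 where N1: "\<And>N. N \<ge> N1 \<Longrightarrow> Q N (\<rho> N) 1" using \<rho>[of 1] by auto
  have "\<rho> N \<in> quad_meshes N (pN N) \<and> isotropic_mesh N (pN N) (\<rho> N)" if "N \<ge> N1" for N
    using N1[OF that] by (simp add: Q_def)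
  moreover have "\<exists>N0>0. \<forall>N\<ge>N0. \<forall>v\<in>quad_vertices N (pN N). norm (\<rho> N v - l v) \<le> \<epsilon>" if "\<epsilon> > 0" for \<epsilon>
    using \<rho>[OF that] unfolding Q_def by blast
  ultimately show ?thesis by blast
qed

end
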